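(* For every prime ideal $P$ minimal over $\mathcal{I}^{\langle n\rangle}$, the $P$-primary component of $\mathcal{I}^{\langle n\rangle}$ equals $P$; that is, the minimal primary components of $\mathcal{I}^{\langle n\rangle}$ are prime ideals.
   Context: Fix positive integers $n, r_1,\dots,r_n$, let $N=[r_1]\times\cdots\times[r_n]$, and let $R$ be the polynomial ring over a field in the variables $x_a$, $a\in N$. For $a,b\in N$ and $i\in[n]$, ${\rm s}(i,a,b)\in N$ is the element whose $i$-th component is $b_i$ and whose other components agree with $a$. Let $d(a,b)=\#\{j: a_j\neq b_j\}$ and $f_{i,a,b}=x_ax_b-x_{{\rm s}(i,a,b)}x_{{\rm s}(i,b,a)}$. Define $\mathcal{I}^{\langle n\rangle}=(f_{i,a,b}: a,b\in N,\ d(a,b)=2,\ i\in[n])$, the ideal generated by the $2\times 2$ minors of all two-dimensional slices of the generic $r_1\times\cdots\times r_n$ hypermatrix. *)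

theory Defs
  imports "HOL-Library.Poly_Mapping" "HOL-Algebra.Ideal"
begin

(* Polynomials over a field 'k in variables indexed by 'v:
   a polynomial is a finitely supported map from monomials (exponent
   vectors 'v \<Rightarrow>\<^sub>0 nat) to coefficients. *)
type_synonym ('v, 'k) mpoly = "('v \<Rightarrow>\<^sub>0 nat) \<Rightarrow>\<^sub>0 'k"

definition poly_ring :: "'v set \<Rightarrow> ('v, 'k::field) mpoly ring" where
  "poly_ring V = \<lparr>carrier = {p :: ('v, 'k) mpoly. \<forall>m \<in> Poly_Mapping.keys p. Poly_Mapping.keys m \<subseteq> V},
                   mult = (*), one = 1, zero = 0, add = (+)\<rparr>"

definition Var :: "'v \<Rightarrow> ('v, 'k::field) mpoly" where
  "Var a = Poly_Mapping.single (Poly_Mapping.single a 1) 1"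

(* N = [r_1] x ... x [r_n], elements encoded as lists of length n,
   coordinates indexed 0..n-1 *)
definition Nset :: "nat \<Rightarrow> (nat \<Rightarrow> nat) \<Rightarrow> nat list set" where
  "Nset n r = {a. length a = n \<and> (\<forall>i<n. 1 \<le> a ! i \<and> a ! i \<le> r i)}"

definition sw :: "nat \<Rightarrow> nat list \<Rightarrow> nat list \<Rightarrow> nat list" where
  "sw i a b = a[i := b ! i]"

definition hdist :: "nat \<Rightarrow> nat list \<Rightarrow> nat list \<Rightarrow> nat" where
  "hdist n a b = card {j. j < n \<and> a ! j \<noteq> b ! j}"

definition fgen :: "nat \<Rightarrow> nat list \<Rightarrow> nat list \<Rightarrow> (nat list, 'k::field) mpoly" where
  "fgen i a b = Var a * Var b - Var (sw i a b) * Var (sw i b a)"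

definition slice_ideal :: "nat \<Rightarrow> (nat \<Rightarrow> nat) \<Rightarrow> (nat list, 'k::field) mpoly set" where
  "slice_ideal n r = genideal (poly_ring (Nset n r))
      {fgen i a b | i a b. a \<in> Nset n r \<and> b \<in> Nset n r \<and> hdist n a b = 2 \<and> i < n}"

definition radical_of :: "('a, 'b) ring_scheme \<Rightarrow> 'a set \<Rightarrow> 'a set" where
  "radical_of R I = {a \<in> carrier R. \<exists>k::nat. a [^]\<^bsub>R\<^esub> k \<in> I}"

definition primary_ideal :: "'a set \<Rightarrow> ('a, 'b) ring_scheme \<Rightarrow> bool" where
  "primary_ideal Q R \<longleftrightarrow> ideal Q R \<and> Q \<noteq> carrier R \<and>
     (\<forall>a \<in> carrier R. \<forall>b \<in> carrier R. a \<otimes>\<^bsub>R\<^esub> b \<in> Q \<longrightarrow>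
        a \<in> Q \<or> (\<exists>k::nat. b [^]\<^bsub>R\<^esub> k \<in> Q))"

definition minimal_prime_over :: "'a set \<Rightarrow> ('a, 'b) ring_scheme \<Rightarrow> 'a set \<Rightarrow> bool" where
  "minimal_prime_over P R I \<longleftrightarrow> primeideal P R \<and> I \<subseteq> P \<and>
     (\<forall>P'. primeideal P' R \<and> I \<subseteq> P' \<and> P' \<subseteq> P \<longrightarrow> P' = P)"

definition minimal_primary_decomposition ::
    "('a, 'b) ring_scheme \<Rightarrow> 'a set \<Rightarrow> 'a set set \<Rightarrow> bool" where
  "minimal_primary_decomposition R I \<Q> \<longleftrightarrow>
     finite \<Q> \<and> (\<forall>Q \<in> \<Q>. primary_ideal Q R) \<and> \<Inter>\<Q> = I \<and>
     inj_on (radical_of R) \<Q> \<and> (\<forall>Q \<in> \<Q>. \<Inter>(\<Q> - {Q}) \<noteq> I)"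

end

theory Submission
  imports Defs "HOL-Library.List_Lexorder"
begin

text \<open>
  Let \<open>P\<close> be minimal over the ideal \<open>I\<close> of slice minors, let \<open>Q \<supseteq> I\<close> be \<open>P\<close>-primary, and let \<open>S\<close> be the
  set of indices \<open>a\<close> with \<open>x\<^sub>a \<notin> P\<close>. As \<open>P\<close> is prime, \<open>S\<close> is closed under switching one of two differing
  coordinates, so its connected components (with respect to changing one coordinate at a time) are
  boxes, and any two components have Hamming distance at least 3. Modulo \<open>Q\<close> the variables of \<open>S\<close> can
  be cancelled, so \<open>Q\<close> contains all Segre relations of each component. Hence, by minimality, \<open>P\<close> is the
  kernel of the map that parametrises each component as a Segre variety and kills the other variables,
  and it remains to see that \<open>x\<^sub>a \<in> Q\<close> for \<open>a \<notin> S\<close>.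

  For \<open>a \<notin> S\<close>, up to multiplication by variables of \<open>S\<close>, \<open>x\<^sub>a\<close> is congruent modulo \<open>Q\<close> to a multiple of
  a product \<open>x\<^sub>b x\<^sub>b\<^sub>'\<close> with \<open>b, b' \<notin> S\<close>: otherwise \<open>S\<close> could be enlarged, either by the isolated point
  \<open>a\<close> or by a slab that extends one of the boxes, and the kernel attached to the larger set would be a
  prime over \<open>I\<close> strictly below \<open>P\<close>. Since the variables outside \<open>S\<close> are nilpotent modulo \<open>Q\<close>, a
  Nakayama argument gives \<open>x\<^sub>a \<in> Q\<close>.
\<close>

section \<open>Polynomial rings and monomial homomorphisms\<close>

lemma poly_ring_simps [simp]:
  "x \<in> carrier (poly_ring V) \<longleftrightarrow> (\<forall>m \<in> Poly_Mapping.keys x. Poly_Mapping.keys m \<subseteq> V)"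
  "mult (poly_ring V) = (*)" "one (poly_ring V) = 1"
  "zero (poly_ring V) = 0" "add (poly_ring V) = (+)"
  by (simp_all add: poly_ring_def)

lemma keys_add_nat: "Poly_Mapping.keys (p + q) = Poly_Mapping.keys p \<union> Poly_Mapping.keys q"
  for p q :: "'v \<Rightarrow>\<^sub>0 nat"
  by (auto simp: in_keys_iff lookup_add)

lemma keys_diff_nat: "Poly_Mapping.keys (p - q) \<subseteq> Poly_Mapping.keys p"
  for p q :: "'v \<Rightarrow>\<^sub>0 nat"
  by (auto simp: in_keys_iff lookup_minus)

lemma poly_ring_mult_closed:
  assumes "x \<in> carrier (poly_ring V)" "y \<in> carrier (poly_ring V)"
  shows "x * y \<in> carrier (poly_ring V)"
  using assms keys_mult [of x y] by (fastforce simp: keys_add_nat)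

lemma poly_ring_add_closed:
  assumes "x \<in> carrier (poly_ring V)" "y \<in> carrier (poly_ring V)"
  shows "x + y \<in> carrier (poly_ring V)"
  using assms Poly_Mapping.keys_add [of x y] by auto

lemma poly_ring_uminus_closed:
  assumes "x \<in> carrier (poly_ring V)"
  shows "- x \<in> carrier (poly_ring V)"
  using assms by (simp add: in_keys_iff)

lemma cring_poly_ring: "cring (poly_ring V :: ('v, 'k::field) mpoly ring)"
proof (rule cringI)
  show "abelian_group (poly_ring V :: ('v, 'k) mpoly ring)"
  proof (rule abelian_groupI)
    fix x :: "('v, 'k) mpoly"
    assume x: "x \<in> carrier (poly_ring V)"
    show "\<exists>y\<in>carrier (poly_ring V). y \<oplus>\<^bsub>poly_ring V\<^esub> x = \<zero>\<^bsub>poly_ring V\<^esub>"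
      by (rule bexI [OF _ poly_ring_uminus_closed [OF x]]) simp
  qed (use poly_ring_add_closed in \<open>auto simp: add.assoc add.commute simp del: poly_ring_simps(1)\<close>, simp)
  show "comm_monoid (poly_ring V :: ('v, 'k) mpoly ring)"
    by (rule comm_monoidI)
      (use poly_ring_mult_closed in \<open>auto simp: mult.assoc mult.commute simp del: poly_ring_simps(1)\<close>, simp)
qed (simp add: algebra_simps)

lemma poly_ring_pow [simp]: "x [^]\<^bsub>poly_ring V\<^esub> (k::nat) = x ^ k"
proof -
  interpret cring "poly_ring V" by (rule cring_poly_ring)
  show ?thesis
    by (induction k) (simp_all add: mult.commute)
qed

lemma poly_ring_a_inv:
  assumes "x \<in> carrier (poly_ring V)"
  shows "\<ominus>\<^bsub>poly_ring V\<^esub> x = - x"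
proof -
  interpret cring "poly_ring V" by (rule cring_poly_ring)
  have "- x \<oplus>\<^bsub>poly_ring V\<^esub> x = \<zero>\<^bsub>poly_ring V\<^esub>"
    by simp
  then show ?thesis
    using minus_equality assms poly_ring_uminus_closed by blast
qed

lemma single_in_poly_ring: "Poly_Mapping.keys m \<subseteq> V \<Longrightarrow> Poly_Mapping.single m c \<in> carrier (poly_ring V)"
  by simp

lemma Var_in_poly_ring: "a \<in> V \<Longrightarrow> Var a \<in> carrier (poly_ring V)"
  by (simp add: Var_def)

lemma poly_ring_idealI:
  fixes K :: "('v, 'k::field) mpoly set"
  assumes "K \<subseteq> carrier (poly_ring V)" "0 \<in> K" "\<And>x y. x \<in> K \<Longrightarrow> y \<in> K \<Longrightarrow> x + y \<in> K"
    and mult: "\<And>x y. x \<in> carrier (poly_ring V) \<Longrightarrow> y \<in> K \<Longrightarrow> x * y \<in> K"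
  shows "ideal K (poly_ring V)"
proof (rule idealI)
  interpret cring "poly_ring V" by (rule cring_poly_ring)
  show "ring (poly_ring V)" by (rule ring_axioms)
  have "- x \<in> K" if "x \<in> K" for x
    using mult [OF poly_ring_uminus_closed [of 1 V] that] by simp
  then show "subgroup K (add_monoid (poly_ring V))"
    using assms(1-3) by (intro add.subgroupI) (auto simp: poly_ring_a_inv simp flip: a_inv_def simp del: poly_ring_simps(1))
  fix a x :: "('v, 'k) mpoly"
  assume *: "a \<in> K" "x \<in> carrier (poly_ring V)"
  show "x \<otimes>\<^bsub>poly_ring V\<^esub> a \<in> K" "a \<otimes>\<^bsub>poly_ring V\<^esub> x \<in> K"
    using mult [OF *(2,1)] by (simp_all add: mult.commute)
qed

context
  fixes K :: "('v, 'k::field) mpoly set" and V :: "'v set"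
  assumes K: "ideal K (poly_ring V)"
begin

lemma poly_ideal_subset: "K \<subseteq> carrier (poly_ring V)"
  using ideal.axioms(1) [OF K] by (rule additive_subgroup.a_subset)

lemma poly_ideal_zero: "0 \<in> K"
  using additive_subgroup.zero_closed [OF ideal.axioms(1) [OF K]] by simp

lemma poly_ideal_add: "x \<in> K \<Longrightarrow> y \<in> K \<Longrightarrow> x + y \<in> K"
  using additive_subgroup.a_closed [OF ideal.axioms(1) [OF K]] by simp

lemma poly_ideal_mult: "x \<in> carrier (poly_ring V) \<Longrightarrow> y \<in> K \<Longrightarrow> x * y \<in> K"
  using ideal.I_l_closed [OF K] by (simp del: poly_ring_simps(1))

lemma poly_ideal_uminus: "x \<in> K \<Longrightarrow> - x \<in> K"
  using poly_ideal_mult [OF poly_ring_uminus_closed [of 1 V], of x] by simp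

lemma poly_ideal_diff: "x \<in> K \<Longrightarrow> y \<in> K \<Longrightarrow> x - y \<in> K"
  using poly_ideal_add [of x "- y"] poly_ideal_uminus by simp

lemma poly_ideal_sum: "(\<And>i. i \<in> A \<Longrightarrow> g i \<in> K) \<Longrightarrow> sum g A \<in> K"
  by (induction A rule: infinite_finite_induct) (auto intro: poly_ideal_zero poly_ideal_add)

lemma poly_ideal_single:
  assumes "Poly_Mapping.single m 1 \<in> K"
  shows "Poly_Mapping.single m c \<in> K"
  using poly_ideal_mult [OF single_in_poly_ring [of 0 V c] assms] by (simp add: mult_single)

lemma poly_ideal_single_add:
  assumes "Poly_Mapping.single m 1 \<in> K" "Poly_Mapping.keys m' \<subseteq> V"
  shows "Poly_Mapping.single (m' + m) 1 \<in> K"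
  using poly_ideal_mult [OF single_in_poly_ring [of m' V 1] assms(1)] assms(2) by (simp add: mult_single)

end

section \<open>Homomorphisms given on monomials, and their kernels\<close>

lemma sum_single_lookup: "(\<Sum>m\<in>Poly_Mapping.keys f. Poly_Mapping.single m (Poly_Mapping.lookup f m)) = f"
proof (rule poly_mapping_eqI)
  fix e
  have "Poly_Mapping.lookup (\<Sum>m\<in>Poly_Mapping.keys f. Poly_Mapping.single m (Poly_Mapping.lookup f m)) e
      = (\<Sum>m\<in>Poly_Mapping.keys f. if e = m then Poly_Mapping.lookup f m else 0)"
    unfolding lookup_sum by (rule sum.cong) (auto simp: lookup_single when_def)
  also have "\<dots> = Poly_Mapping.lookup f e"
    by (auto simp: in_keys_iff)
  finally show "Poly_Mapping.lookup (\<Sum>m\<in>Poly_Mapping.keys f. Poly_Mapping.single m (Poly_Mapping.lookup f m)) e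
      = Poly_Mapping.lookup f e" .
qed

text \<open>For additive \<open>\<Phi>\<close> this is the algebra map that kills the variables
  outside \<open>S\<close> and transforms all other exponent vectors by
  \<open>\<Phi>\<close>.\<close>

definition mono_hom :: "'v set \<Rightarrow> (('v \<Rightarrow>\<^sub>0 nat) \<Rightarrow> ('w \<Rightarrow>\<^sub>0 nat)) \<Rightarrow> ('v, 'k::field) mpoly \<Rightarrow> ('w, 'k) mpoly" where
  "mono_hom S \<Phi> f = (\<Sum>m\<in>Poly_Mapping.keys f.
     if Poly_Mapping.keys m \<subseteq> S then Poly_Mapping.single (\<Phi> m) (Poly_Mapping.lookup f m) else 0)"

lemma mono_hom_superset:
  assumes "finite A" "Poly_Mapping.keys f \<subseteq> A"
  shows "mono_hom S \<Phi> f = (\<Sum>m\<in>A.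
     if Poly_Mapping.keys m \<subseteq> S then Poly_Mapping.single (\<Phi> m) (Poly_Mapping.lookup f m) else 0)"
  unfolding mono_hom_def by (rule sum.mono_neutral_left) (use assms in \<open>auto simp: in_keys_iff\<close>)

lemma mono_hom_add: "mono_hom S \<Phi> (f + g) = mono_hom S \<Phi> f + mono_hom S \<Phi> g"
proof -
  let ?A = "Poly_Mapping.keys f \<union> Poly_Mapping.keys g"
  have "finite ?A" by simp
  then show ?thesis
    using Poly_Mapping.keys_add [of f g]
    by (simp add: mono_hom_superset [of ?A] sum.distrib [symmetric] lookup_add single_add if_distrib cong: if_cong)
qed

lemma mono_hom_0 [simp]: "mono_hom S \<Phi> 0 = 0"
  by (simp add: mono_hom_def)

lemma mono_hom_sum: "mono_hom S \<Phi> (sum g A) = (\<Sum>i\<in>A. mono_hom S \<Phi> (g i))"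
  by (induction A rule: infinite_finite_induct) (simp_all add: mono_hom_add)

lemma mono_hom_single:
  "mono_hom S \<Phi> (Poly_Mapping.single m c) =
    (if Poly_Mapping.keys m \<subseteq> S then Poly_Mapping.single (\<Phi> m) c else 0)"
  by (subst mono_hom_superset [of "{m}"]) auto

lemma mono_hom_uminus: "mono_hom S \<Phi> (- f) = - mono_hom S \<Phi> f"
  using mono_hom_add [of S \<Phi> f "- f"] by (simp add: minus_unique)

lemma mono_hom_diff: "mono_hom S \<Phi> (f - g) = mono_hom S \<Phi> f - mono_hom S \<Phi> g"
  using mono_hom_add [of S \<Phi> f "- g"] by (simp add: mono_hom_uminus)

lemma mono_hom_mult:
  assumes "\<And>m m'. \<Phi> (m + m') = \<Phi> m + \<Phi> m'"
  shows "mono_hom S \<Phi> (f * g) = mono_hom S \<Phi> f * mono_hom S \<Phi> g"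
proof -
  have "f * g = (\<Sum>m\<in>Poly_Mapping.keys f. \<Sum>m'\<in>Poly_Mapping.keys g.
      Poly_Mapping.single (m + m') (Poly_Mapping.lookup f m * Poly_Mapping.lookup g m'))"
    by (subst (1) sum_single_lookup [of f, symmetric], subst (1) sum_single_lookup [of g, symmetric])
      (simp add: sum_product mult_single)
  then show ?thesis
    by (simp add: mono_hom_sum mono_hom_single sum_product keys_add_nat)
      (auto simp: mono_hom_def sum_product mult_single assms intro!: sum.cong)
qed

text \<open>Coefficients add up over the fibres of \<open>\<Phi>\<close>. Membership in the kernel
  thus becomes one linear condition per fibre, on which both comparisons of kernels below
  rest.\<close>

lemma lookup_mono_hom:
  "Poly_Mapping.lookup (mono_hom S \<Phi> f) e =
    (\<Sum>m\<in>{m \<in> Poly_Mapping.keys f. Poly_Mapping.keys m \<subseteq> S \<and> \<Phi> m = e}. Poly_Mapping.lookup f m)"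
  unfolding mono_hom_def lookup_sum
  by (rule sum.mono_neutral_cong_right) (auto simp: lookup_single)

definition mono_ker :: "'v set \<Rightarrow> 'v set \<Rightarrow> (('v \<Rightarrow>\<^sub>0 nat) \<Rightarrow> ('w \<Rightarrow>\<^sub>0 nat)) \<Rightarrow> ('v, 'k::field) mpoly set" where
  "mono_ker V S \<Phi> = {f \<in> carrier (poly_ring V). mono_hom S \<Phi> f = 0}"

text \<open>A kernel of a ring map into a domain is prime. The order on \<open>'w\<close> makes the
  exponent vectors of the target a linearly ordered monoid, so that the target has no zero
  divisors.\<close>

lemma primeideal_mono_ker:
  fixes \<Phi> :: "('v \<Rightarrow>\<^sub>0 nat) \<Rightarrow> ('w::linorder \<Rightarrow>\<^sub>0 nat)"
  assumes \<Phi>: "\<And>m m'. \<Phi> (m + m') = \<Phi> m + \<Phi> m'"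
  shows "primeideal (mono_ker V S \<Phi> :: ('v, 'k::field) mpoly set) (poly_ring V)"
proof (rule primeidealI)
  show "ideal (mono_ker V S \<Phi> :: ('v, 'k) mpoly set) (poly_ring V)"
    by (rule poly_ring_idealI)
      (auto simp: mono_ker_def mono_hom_add mono_hom_mult \<Phi> simp del: poly_ring_simps(1)
        intro: poly_ring_add_closed poly_ring_mult_closed, simp)
  have "\<Phi> 0 = 0"
    using \<Phi> [of 0 0] by simp
  then have "mono_hom S \<Phi> (1 :: ('v, 'k) mpoly) = 1"
    using mono_hom_single [of S \<Phi> 0 "1::'k"] by simp
  then have "(1 :: ('v, 'k) mpoly) \<notin> mono_ker V S \<Phi>"
    by (simp add: mono_ker_def)
  then show "carrier (poly_ring V) \<noteq> (mono_ker V S \<Phi> :: ('v, 'k) mpoly set)"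
    by (metis cring_poly_ring cring.cring_simprules(6) poly_ring_simps(3))
qed (auto simp: mono_ker_def mono_hom_mult \<Phi> cring_poly_ring simp del: poly_ring_simps(1))

text \<open>Following the larger map by killing all target variables outside \<open>S\<close> gives
  the smaller map: by \<open>iff\<close>, the monomials over \<open>S\<close> are exactly those over
  \<open>S'\<close> whose image stays over \<open>S\<close>.\<close>

lemma mono_ker_mono:
  assumes "S \<subseteq> S'" and eq: "\<And>m. Poly_Mapping.keys m \<subseteq> S \<Longrightarrow> \<Phi>' m = \<Phi> m"
    and iff: "\<And>m. Poly_Mapping.keys m \<subseteq> S' \<Longrightarrow> Poly_Mapping.keys m \<subseteq> S \<longleftrightarrow> Poly_Mapping.keys (\<Phi>' m) \<subseteq> S"
  shows "mono_ker V S' \<Phi>' \<subseteq> (mono_ker V S \<Phi> :: ('v, 'k::field) mpoly set)"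
proof
  fix f :: "('v, 'k) mpoly"
  assume f: "f \<in> mono_ker V S' \<Phi>'"
  have "Poly_Mapping.lookup (mono_hom S \<Phi> f) e = 0" for e
  proof (cases "Poly_Mapping.keys e \<subseteq> S")
    case True
    have "Poly_Mapping.keys m \<subseteq> S \<and> \<Phi> m = e \<longleftrightarrow> Poly_Mapping.keys m \<subseteq> S' \<and> \<Phi>' m = e" for m
      using True assms(1) eq [of m] iff [of m] by auto
    then have "Poly_Mapping.lookup (mono_hom S \<Phi> f) e = Poly_Mapping.lookup (mono_hom S' \<Phi>' f) e"
      by (simp add: lookup_mono_hom)
    then show ?thesis using f by (simp add: mono_ker_def)
  next
    case False
    have "Poly_Mapping.keys (\<Phi> m) \<subseteq> S" if "Poly_Mapping.keys m \<subseteq> S" for m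
      using that assms(1) eq [of m] iff [of m] by auto
    then have "{m \<in> Poly_Mapping.keys f. Poly_Mapping.keys m \<subseteq> S \<and> \<Phi> m = e} = {}"
      using False by blast
    then show ?thesis unfolding lookup_mono_hom by (simp only: sum.empty)
  qed
  then have "mono_hom S \<Phi> f = 0"
    by (intro poly_mapping_eqI) simp
  then show "f \<in> mono_ker V S \<Phi>"
    using f by (simp add: mono_ker_def)
qed

text \<open>Monomials with a variable outside \<open>S\<close> lie in \<open>K\<close> by
  \<open>out\<close>. On the others, the coefficients of a kernel element sum to 0 over each fibre
  of \<open>\<Phi>\<close>, so each fibre contributes a combination of the binomials in
  \<open>fibre\<close>.\<close>

lemma mono_ker_subset_ideal:
  fixes K :: "('v, 'k::field) mpoly set"
  assumes K: "ideal K (poly_ring V)" and "S \<subseteq> V"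
    and out: "\<And>a. a \<in> V \<Longrightarrow> a \<notin> S \<Longrightarrow> Var a \<in> K"
    and fibre: "\<And>m m'. Poly_Mapping.keys m \<subseteq> S \<Longrightarrow> Poly_Mapping.keys m' \<subseteq> S \<Longrightarrow> \<Phi> m = \<Phi> m' \<Longrightarrow>
       Poly_Mapping.single m 1 - Poly_Mapping.single m' 1 \<in> K"
  shows "mono_ker V S \<Phi> \<subseteq> K"
proof
  fix f :: "('v, 'k) mpoly"
  assume f: "f \<in> mono_ker V S \<Phi>"
  let ?t = "\<lambda>m. Poly_Mapping.single m (Poly_Mapping.lookup f m)"
  define M where "M = {m \<in> Poly_Mapping.keys f. Poly_Mapping.keys m \<subseteq> S}"
  have fin: "finite M" by (simp add: M_def)
  have "?t m \<in> K" if m: "m \<in> Poly_Mapping.keys f - M" for m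
  proof -
    obtain a where a: "a \<in> Poly_Mapping.keys m" "a \<notin> S"
      using m by (auto simp: M_def)
    have mV: "Poly_Mapping.keys m \<subseteq> V"
      using f m by (auto simp: mono_ker_def)
    have "m = (m - Poly_Mapping.single a 1) + Poly_Mapping.single a 1"
      using a by (intro poly_mapping_eqI) (auto simp: lookup_add lookup_minus lookup_single when_def in_keys_iff)
    moreover have "Poly_Mapping.keys (m - Poly_Mapping.single a 1) \<subseteq> V"
      using mV keys_diff_nat [of m] by (rule subset_trans [rotated])
    moreover have "Poly_Mapping.single (Poly_Mapping.single a 1) 1 \<in> K"
      using out [of a] a mV by (auto simp: Var_def)
    ultimately show ?thesis
      using poly_ideal_single [OF K] poly_ideal_single_add [OF K] by metis
  qed
  then have 1: "sum ?t (Poly_Mapping.keys f - M) \<in> K"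
    by (rule poly_ideal_sum [OF K])
  have 2: "sum ?t M \<in> K"
  proof -
    have "sum ?t {m \<in> M. \<Phi> m = e} \<in> K" if e: "e \<in> \<Phi> ` M" for e
    proof -
      \<comment> \<open>Every monomial of the fibre is traded for the representative
        \<open>m0\<close>, whose accumulated coefficient is a coefficient of the image of
        \<open>f\<close>, hence 0.\<close>
      obtain m0 where m0: "m0 \<in> M" "\<Phi> m0 = e" using e by auto
      have "?t m - Poly_Mapping.single m0 (Poly_Mapping.lookup f m) \<in> K" if "m \<in> {m \<in> M. \<Phi> m = e}" for m
      proof -
        have "Poly_Mapping.single m 1 - Poly_Mapping.single m0 1 \<in> K"
          using that m0 by (intro fibre) (auto simp: M_def)
        from poly_ideal_mult [OF K single_in_poly_ring [of 0 V "Poly_Mapping.lookup f m"] this]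
        show ?thesis by (simp add: right_diff_distrib mult_single)
      qed
      then have "(\<Sum>m\<in>{m \<in> M. \<Phi> m = e}. ?t m - Poly_Mapping.single m0 (Poly_Mapping.lookup f m)) \<in> K"
        by (rule poly_ideal_sum [OF K])
      moreover have "(\<Sum>m\<in>{m \<in> M. \<Phi> m = e}. Poly_Mapping.single m0 (Poly_Mapping.lookup f m))
          = Poly_Mapping.single m0 (\<Sum>m\<in>{m \<in> M. \<Phi> m = e}. Poly_Mapping.lookup f m)"
        by (intro poly_mapping_eqI) (simp add: lookup_sum lookup_single when_def)
      moreover have "(\<Sum>m\<in>{m \<in> M. \<Phi> m = e}. Poly_Mapping.lookup f m) = Poly_Mapping.lookup (mono_hom S \<Phi> f) e"
        unfolding lookup_mono_hom by (rule sum.cong) (auto simp: M_def)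
      ultimately show ?thesis
        using f by (simp add: mono_ker_def sum_subtractf)
    qed
    then have "(\<Sum>e\<in>\<Phi> ` M. sum ?t {m \<in> M. \<Phi> m = e}) \<in> K"
      by (rule poly_ideal_sum [OF K])
    then show ?thesis
      by (simp add: sum.image_gen [OF fin, of ?t \<Phi>])
  qed
  have "sum ?t (Poly_Mapping.keys f) = sum ?t (Poly_Mapping.keys f - M) + sum ?t M"
    by (rule sum.subset_diff) (auto simp: M_def)
  then show "f \<in> K"
    using poly_ideal_add [OF K 1 2] by (simp add: sum_single_lookup)
qed

section \<open>Induction on monomials and additive maps on exponents\<close>

lemma monomial_induct [consumes 1, case_names zero add]:
  assumes "Poly_Mapping.keys m \<subseteq> S" and "P 0"
    and step: "\<And>m a. Poly_Mapping.keys m \<subseteq> S \<Longrightarrow> a \<in> S \<Longrightarrow> P m \<Longrightarrow> P (m + Poly_Mapping.single a (1::nat))"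
  shows "P m"
  using assms(1)
proof (induction "\<Sum>a\<in>Poly_Mapping.keys m. Poly_Mapping.lookup m a" arbitrary: m)
  case 0
  then have "m = 0"
    by (intro poly_mapping_eqI) (auto simp: in_keys_iff)
  then show ?case using assms(2) by simp
next
  case (Suc k)
  then obtain a where a: "a \<in> Poly_Mapping.keys m"
    by fastforce
  define m' where "m' = m - Poly_Mapping.single a 1"
  have m: "m = m' + Poly_Mapping.single a 1"
    using a by (intro poly_mapping_eqI)
      (auto simp: m'_def lookup_add lookup_minus lookup_single when_def in_keys_iff)
  have sub: "Poly_Mapping.keys m' \<subseteq> Poly_Mapping.keys m"
    unfolding m'_def by (rule keys_diff_nat)
  have "(\<Sum>b\<in>Poly_Mapping.keys m. Poly_Mapping.lookup m b)
      = (\<Sum>b\<in>Poly_Mapping.keys m. Poly_Mapping.lookup m' b) + (\<Sum>b\<in>Poly_Mapping.keys m. if b = a then 1 else 0)"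
    unfolding sum.distrib [symmetric]
    by (rule sum.cong) (auto simp: m lookup_add lookup_single when_def)
  moreover have "(\<Sum>b\<in>Poly_Mapping.keys m. Poly_Mapping.lookup m' b) = (\<Sum>b\<in>Poly_Mapping.keys m'. Poly_Mapping.lookup m' b)"
    by (rule sum.mono_neutral_right) (use sub in \<open>auto simp: in_keys_iff\<close>)
  ultimately have "k = (\<Sum>b\<in>Poly_Mapping.keys m'. Poly_Mapping.lookup m' b)"
    using Suc.hyps(2) a by simp
  then have "P m'"
    using Suc.hyps(1) sub Suc.prems by blast
  then show ?case
    using step [of m' a] m sub a Suc.prems by auto
qed

lemma single_1_neq_0: "Poly_Mapping.single a (1::'b::zero_neq_one) \<noteq> 0"
  by (metis lookup_single_eq lookup_zero one_neq_zero)

lemma Var_power: "Var a ^ k = (Poly_Mapping.single (Poly_Mapping.single a k) 1 :: ('v, 'k::field) mpoly)"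
  by (induction k) (simp_all add: Var_def mult_single flip: single_add)

lemma prod_single_1:
  "(\<Prod>i\<in>A. Poly_Mapping.single (g i) 1) = (Poly_Mapping.single (\<Sum>i\<in>A. g i) 1 :: ('v, 'k::field) mpoly)"
  by (induction A rule: infinite_finite_induct) (simp_all add: mult_single)

lemma keys_sum_nat: "finite A \<Longrightarrow> Poly_Mapping.keys (sum g A) = (\<Union>i\<in>A. Poly_Mapping.keys (g i :: 'v \<Rightarrow>\<^sub>0 nat))"
  by (induction A rule: finite_induct) (simp_all add: keys_add_nat)

text \<open>The additive extension of \<open>\<phi>\<close> from variables to exponent vectors. The
  inner sum is a multiple by a natural number, spelled out as a repeated sum because the target is
  only a commutative monoid.\<close>

definition lin_ext :: "'v set \<Rightarrow> ('v \<Rightarrow> 'e) \<Rightarrow> ('v \<Rightarrow>\<^sub>0 nat) \<Rightarrow> 'e::comm_monoid_add" where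
  "lin_ext V \<phi> m = (\<Sum>a\<in>V. \<Sum>k<Poly_Mapping.lookup m a. \<phi> a)"

lemma lin_ext_add:
  fixes \<phi> :: "'v \<Rightarrow> 'e::comm_monoid_add"
  shows "lin_ext V \<phi> (m + m') = lin_ext V \<phi> m + lin_ext V \<phi> m'"
proof -
  have "(\<Sum>k<x + y. c) = (\<Sum>k<x. c) + (\<Sum>k<y. c)" for x y :: nat and c :: 'e
    by (induction y) (simp_all add: add.assoc)
  then show ?thesis
    by (simp add: lin_ext_def lookup_add sum.distrib)
qed

lemma lin_ext_0 [simp]: "lin_ext V \<phi> 0 = 0"
  by (simp add: lin_ext_def)

lemma lin_ext_sum: "lin_ext V \<phi> (sum g A) = (\<Sum>i\<in>A. lin_ext V \<phi> (g i))"
  by (induction A rule: infinite_finite_induct) (simp_all add: lin_ext_add)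

lemma lin_ext_single:
  assumes "finite V" "a \<in> V"
  shows "lin_ext V \<phi> (Poly_Mapping.single a 1) = \<phi> a"
proof -
  have "lin_ext V \<phi> (Poly_Mapping.single a 1) = (\<Sum>b\<in>V. if a = b then \<phi> b else 0)"
    unfolding lin_ext_def by (rule sum.cong) (auto simp: lookup_single when_def)
  then show ?thesis using assms by simp
qed

lemma lin_ext_cong:
  assumes "\<And>a. a \<in> Poly_Mapping.keys m \<Longrightarrow> \<phi> a = \<psi> a"
  shows "lin_ext V \<phi> m = lin_ext V \<psi> m"
proof -
  have "(\<Sum>k<Poly_Mapping.lookup m a. \<phi> a) = (\<Sum>k<Poly_Mapping.lookup m a. \<psi> a)" for a
    using assms [of a] by (cases "a \<in> Poly_Mapping.keys m") (auto simp: in_keys_iff)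
  then show ?thesis by (simp add: lin_ext_def)
qed

text \<open>Exponents are natural numbers, so nothing cancels and supports simply unite.\<close>

lemma keys_lin_ext:
  assumes "finite V" "Poly_Mapping.keys m \<subseteq> V"
  shows "Poly_Mapping.keys (lin_ext V \<phi> m) = (\<Union>a\<in>Poly_Mapping.keys m. Poly_Mapping.keys (\<phi> a :: 'w \<Rightarrow>\<^sub>0 nat))"
proof -
  have "Poly_Mapping.keys (\<Sum>k<j. \<phi> a) = (if j = 0 then {} else Poly_Mapping.keys (\<phi> a))" for j :: nat and a
    by (auto simp: keys_sum_nat)
  then have "Poly_Mapping.keys (lin_ext V \<phi> m) = (\<Union>a\<in>V. if a \<in> Poly_Mapping.keys m then Poly_Mapping.keys (\<phi> a) else {})"
    using assms(1) by (simp add: lin_ext_def keys_sum_nat in_keys_iff)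
  then show ?thesis using assms(2) by auto
qed

section \<open>Cancellation and nilpotent variables modulo an ideal\<close>

lemma poly_ideal_diff_mult2:
  assumes "ideal K (poly_ring V)" "x - x' \<in> K" "y - y' \<in> K"
    and "x \<in> carrier (poly_ring V)" "y' \<in> carrier (poly_ring V)"
  shows "x * y - x' * y' \<in> K"
  using poly_ideal_add [OF assms(1) poly_ideal_mult [OF assms(1,4,3)] poly_ideal_mult [OF assms(1,5,2)]]
  by (simp add: algebra_simps)

lemma cancel_monomial:
  assumes "\<And>c f. c \<in> S \<Longrightarrow> f \<in> carrier (poly_ring V) \<Longrightarrow> Var c * f \<in> K \<Longrightarrow> f \<in> K"
    and "S \<subseteq> V" and "Poly_Mapping.keys u \<subseteq> S"
    and "f \<in> carrier (poly_ring V)" "Poly_Mapping.single u 1 * f \<in> K"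
  shows "f \<in> K"
  using assms(3-)
proof (induction arbitrary: f rule: monomial_induct)
  case zero
  then show ?case by simp
next
  case (add m a)
  have "Var a * (Poly_Mapping.single m 1 * f) \<in> K"
    using add.prems by (simp add: Var_def mult_single mult.assoc [symmetric] add.commute)
  moreover have "Poly_Mapping.single m 1 \<in> carrier (poly_ring V)"
    using add.hyps \<open>S \<subseteq> V\<close> by (intro single_in_poly_ring) auto
  ultimately show ?case
    using add assms(1) poly_ring_mult_closed by blast
qed

text \<open>A Nakayama argument on degrees. Among the nonconstant monomials over \<open>T\<close>
  outside \<open>K\<close> pick one of maximal degree. Rewriting one of its variables by
  \<open>red\<close> turns it, up to the cancellable \<open>u\<close>, into a multiple of a monomial
  of larger degree, which must lie in \<open>K\<close>.\<close>

lemma nilpotent_variables_in_ideal: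
  fixes K :: "('v, 'k::field) mpoly set"
  assumes K: "ideal K (poly_ring V)" and "finite V" "T \<subseteq> V"
    and nil: "\<And>a. a \<in> T \<Longrightarrow> \<exists>k. Var a ^ k \<in> K"
    and red: "\<And>a. a \<in> T \<Longrightarrow> \<exists>b\<in>T. \<exists>b'\<in>T. \<exists>u. \<exists>t\<in>carrier (poly_ring V).
      (\<forall>f\<in>carrier (poly_ring V). u * f \<in> K \<longrightarrow> f \<in> K) \<and> u * Var a - t * (Var b * Var b') \<in> K"
    and "a \<in> T"
  shows "Var a \<in> K"
proof (rule ccontr)
  assume a: "Var a \<notin> K"
  let ?deg = "\<lambda>m. \<Sum>a\<in>T. Poly_Mapping.lookup m a :: nat"
  define M where "M = (\<lambda>m. Poly_Mapping.keys m \<subseteq> T \<and> m \<noteq> 0 \<and> (Poly_Mapping.single m 1 :: ('v, 'k) mpoly) \<notin> K)"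
  have fT: "finite T" using assms finite_subset by blast
  obtain e where e: "\<And>a. a \<in> T \<Longrightarrow> Var a ^ e a \<in> K"
    using nil by metis
  \<comment> \<open>A monomial with an exponent above \<open>e b\<close> is a multiple of a power of
    \<open>Var b\<close> that lies in \<open>K\<close>; so degrees are bounded and a maximum
    exists.\<close>
  have bound: "?deg m \<le> (\<Sum>a\<in>T. e a)" if "M m" for m
  proof (rule sum_mono, rule ccontr)
    fix b assume b: "b \<in> T" "\<not> Poly_Mapping.lookup m b \<le> e b"
    have "m = (m - Poly_Mapping.single b (e b)) + Poly_Mapping.single b (e b)"
      using b by (intro poly_mapping_eqI) (auto simp: lookup_add lookup_minus lookup_single when_def)
    moreover have "Poly_Mapping.keys (m - Poly_Mapping.single b (e b)) \<subseteq> V"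
      using that \<open>T \<subseteq> V\<close> keys_diff_nat [of m] unfolding M_def by blast
    ultimately have "Poly_Mapping.single m 1 \<in> K"
      using poly_ideal_single_add [OF K] e [OF b(1)] unfolding Var_power by metis
    then show False using that by (simp add: M_def)
  qed
  have "M (Poly_Mapping.single a 1)"
    using a \<open>a \<in> T\<close> single_1_neq_0 [of a, where ?'b = nat] by (simp add: M_def Var_def)
  then obtain m where m: "M m" and max: "\<And>m'. M m' \<Longrightarrow> ?deg m' \<le> ?deg m"
    using ex_has_greatest_nat [of M _ ?deg "(\<Sum>a\<in>T. e a) + 1"] bound by (metis add.commute le_imp_less_Suc plus_1_eq_Suc less_imp_le)
  then obtain c where c: "c \<in> Poly_Mapping.keys m"
    unfolding M_def by (metis equals0I keys_eq_empty)
  then have cT: "c \<in> T" using m by (auto simp: M_def)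
  define m' where "m' = m - Poly_Mapping.single c 1"
  have mm: "m = m' + Poly_Mapping.single c 1"
    using c by (intro poly_mapping_eqI)
      (auto simp: m'_def lookup_add lookup_minus lookup_single when_def in_keys_iff)
  have m'T: "Poly_Mapping.keys m' \<subseteq> T"
    using m mm by (auto simp: M_def keys_add_nat)
  have mono: "Poly_Mapping.single m' 1 \<in> carrier (poly_ring V)" "Poly_Mapping.single m 1 \<in> carrier (poly_ring V)"
    using m'T m \<open>T \<subseteq> V\<close> by (auto simp: M_def)
  obtain b b' u t where b: "b \<in> T" "b' \<in> T" and t: "t \<in> carrier (poly_ring V)"
    and u: "\<And>f. f \<in> carrier (poly_ring V) \<Longrightarrow> u * f \<in> K \<Longrightarrow> f \<in> K"
    and ut: "u * Var c - t * (Var b * Var b') \<in> K"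
    using red [OF cT] by blast
  \<comment> \<open>\<open>q\<close> is \<open>m\<close> with the factor \<open>c\<close> replaced
    by the two factors \<open>b\<close> and \<open>b'\<close>; its degree exceeds that of
    \<open>m\<close> by one.\<close>
  define q where "q = m' + Poly_Mapping.single b 1 + Poly_Mapping.single b' 1"
  have deg1: "?deg (Poly_Mapping.single x 1) = 1" if "x \<in> T" for x
    using that fT by (simp add: lookup_single when_def)
  have "?deg q = ?deg m' + ?deg (Poly_Mapping.single b 1) + ?deg (Poly_Mapping.single b' 1)"
    by (simp add: q_def lookup_add sum.distrib)
  moreover have "?deg m = ?deg m' + ?deg (Poly_Mapping.single c 1)"
    by (subst mm) (simp add: lookup_add sum.distrib)
  ultimately have "?deg q > ?deg m"
    using deg1 b cT by simp
  then have "\<not> M q"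
    using max leD by blast
  moreover have "q \<noteq> 0"
    by (metis q_def add_eq_0_iff_both_eq_0 keys_add_nat keys_eq_empty Un_empty keys_single insert_not_empty one_neq_zero)
  moreover have "Poly_Mapping.keys q \<subseteq> T"
    using m'T b by (simp add: q_def keys_add_nat)
  ultimately have "(Poly_Mapping.single q 1 :: ('v, 'k) mpoly) \<in> K"
    by (simp add: M_def)
  then have "t * Poly_Mapping.single q 1 \<in> K"
    using poly_ideal_mult [OF K t] by simp
  moreover have "Poly_Mapping.single m' 1 * (u * Var c - t * (Var b * Var b')) \<in> K"
    using poly_ideal_mult [OF K mono(1) ut] .
  ultimately have "t * Poly_Mapping.single q 1 + Poly_Mapping.single m' 1 * (u * Var c - t * (Var b * Var b')) \<in> K"
    by (rule poly_ideal_add [OF K])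
  moreover have "(Poly_Mapping.single q 1 :: ('v, 'k) mpoly) = Poly_Mapping.single m' 1 * (Var b * Var b')"
    "(Poly_Mapping.single m 1 :: ('v, 'k) mpoly) = Poly_Mapping.single m' 1 * Var c"
    by (simp_all add: q_def mm Var_def mult_single add.assoc)
  ultimately have "u * Poly_Mapping.single m 1 \<in> K"
    by (simp add: algebra_simps)
  then show False
    using u mono(2) m by (auto simp: M_def)
qed

section \<open>Switchable sets\<close>

text \<open>Two opposite corners of a rectangle in directions \<open>i\<close> and \<open>j\<close>
  force the remaining two. Only one of these is written down; exchanging \<open>i\<close> and
  \<open>j\<close> gives the other.\<close>

definition switchable :: "nat \<Rightarrow> nat list set \<Rightarrow> bool" where
  "switchable n S \<longleftrightarrow> (\<forall>a\<in>S. \<forall>i<n. \<forall>j<n. \<forall>v w. i \<noteq> j \<longrightarrow> a[i := v, j := w] \<in> S \<longrightarrow> a[i := v] \<in> S)"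

definition adj :: "nat \<Rightarrow> nat list set \<Rightarrow> (nat list \<times> nat list) set" where
  "adj n S = {(a, a[j := w]) | a j w. a \<in> S \<and> j < n \<and> a[j := w] \<in> S}"

lemma switchableD:
  assumes "switchable n S" "a \<in> S" "a[i := v, j := w] \<in> S" "i < n" "j < n" "i \<noteq> j"
  shows "a[i := v] \<in> S" "a[j := w] \<in> S"
  using assms unfolding switchable_def by (blast, metis list_update_swap)

lemma adj_sym: "(a, b) \<in> adj n S \<Longrightarrow> (b, a) \<in> adj n S"
  unfolding adj_def by (auto, metis list_update_id list_update_overwrite)

lemma conn_sym: "(a, b) \<in> (adj n S)\<^sup>* \<Longrightarrow> (b, a) \<in> (adj n S)\<^sup>*"
  using adj_sym by (metis sym_rtrancl symD symI)

lemma conn_in: "(a, b) \<in> (adj n S)\<^sup>* \<Longrightarrow> a \<in> S \<Longrightarrow> b \<in> S"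
  by (induction rule: rtrancl_induct) (auto simp: adj_def)

lemma conn_update: "a \<in> S \<Longrightarrow> j < n \<Longrightarrow> a[j := w] \<in> S \<Longrightarrow> (a, a[j := w]) \<in> (adj n S)\<^sup>*"
  by (rule r_into_rtrancl) (auto simp: adj_def)

text \<open>Connected components of a switchable set are boxes.\<close>
lemma conn_box:
  assumes "switchable n S" "(a, b) \<in> (adj n S)\<^sup>*" "a \<in> S" "i < n"
  shows "a[i := b ! i] \<in> S"
  using assms(2,3)
proof (induction rule: converse_rtrancl_induct)
  case base
  then show ?case by simp
next
  case (step a a1)
  then obtain j w where a1: "a1 = a[j := w]" "j < n" "a1 \<in> S"
    by (auto simp: adj_def)
  then have *: "a[j := w, i := b ! i] \<in> S"
    using step by simp
  \<comment> \<open>For \<open>i \<noteq> j\<close> the points \<open>a\<close> and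
    \<open>a[j := w, i := b ! i]\<close> are opposite corners in \<open>S\<close>, so the corner
    \<open>a[i := b ! i]\<close> is in \<open>S\<close> too.\<close>
  show ?case
  proof (cases "i = j")
    case False
    then show ?thesis
      using switchableD(2) [OF assms(1) step.prems *] a1 assms(4) by simp
  qed (use * in simp)
qed

lemma conn_box_conn:
  assumes "switchable n S" "(a, b) \<in> (adj n S)\<^sup>*" "a \<in> S" "i < n"
  shows "(a, a[i := b ! i]) \<in> (adj n S)\<^sup>*"
  using conn_update conn_box [OF assms] assms by blast

text \<open>The obstruction to adding \<open>p\<close> to \<open>S\<close>: the corner opposite to
  \<open>p\<close> is present, but both corners between them are missing. The minor of this
  rectangle later rewrites the variable at \<open>p\<close> as a product of two variables outside
  \<open>S\<close>.\<close>

definition lonely_corner :: "nat \<Rightarrow> nat list set \<Rightarrow> nat list \<Rightarrow> bool" where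
  "lonely_corner n S p \<longleftrightarrow> (\<exists>k<n. \<exists>l<n. \<exists>x y. k \<noteq> l \<and> p[k := x, l := y] \<in> S \<and> p[k := x] \<notin> S \<and> p[l := y] \<notin> S)"

text \<open>Without neighbours in \<open>S\<close> and without a lonely corner, \<open>a\<close> has
  no point of \<open>S\<close> at Hamming distance 2 either, so only degenerate rectangles have
  \<open>a\<close> as one of two opposite present corners.\<close>

lemma switchable_insert:
  assumes "switchable n S" and far: "\<And>i x. i < n \<Longrightarrow> a[i := x] \<notin> S" and "\<not> lonely_corner n S a"
  shows "switchable n (insert a S)"
proof -
  have far2: "a[k := x, l := y] \<notin> S" if "k < n" "l < n" "k \<noteq> l" for k l x y
    using assms(3) far that unfolding lonely_corner_def by blast
  show ?thesis
    unfolding switchable_def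
  proof (intro ballI allI impI)
    fix p k l x y
    assume *: "p \<in> insert a S" "k < n" "l < n" "k \<noteq> l" "p[k := x, l := y] \<in> insert a S"
    consider "p \<in> S" "p[k := x, l := y] \<in> S" | "p = a" "p[k := x, l := y] \<in> S"
      | "p \<in> S" "p[k := x, l := y] = a" | "p = a" "p[k := x, l := y] = a"
      using * by blast
    then show "p[k := x] \<in> insert a S"
    proof cases
      case 1
      then show ?thesis using switchableD assms(1) * by blast
    next
      case 2
      then show ?thesis using far2 * by blast
    next
      case 3
      \<comment> \<open>The rectangle is read backwards, from \<open>a\<close> to
        \<open>p\<close>.\<close>
      then have "a[k := p ! k, l := p ! l] = p"
        using * by (auto simp: list_update_swap [of k l])
      then show ?thesis using far2 * 3 by metis
    next
      case 4
      then have "p[k := x] = p"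
        by (metis *(4) list_update_id list_update_overwrite list_update_swap nth_list_update_eq list_update_beyond not_le nth_list_update_neq)
      then show ?thesis using 4 by simp
    qed
  qed
qed

text \<open>The layer that extends the box of \<open>c\<close> by the new value \<open>v\<close> in
  direction \<open>i\<close>.\<close>

definition slab :: "nat \<Rightarrow> nat list set \<Rightarrow> nat \<Rightarrow> nat \<Rightarrow> nat list \<Rightarrow> nat list set" where
  "slab n S i v c = {c'[i := v] | c'. (c, c') \<in> (adj n S)\<^sup>*}"

section \<open>Extending a component by a slab\<close>

context
  fixes n S i v c
  assumes sw: "switchable n S" and len: "\<And>a. a \<in> S \<Longrightarrow> length a = n"
    and c: "c \<in> S" and i: "i < n" and cv: "c[i := v] \<notin> S"
    and nl: "\<And>c'. (c, c') \<in> (adj n S)\<^sup>* \<Longrightarrow> \<not> lonely_corner n S (c'[i := v])"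
begin

text \<open>A slab point in \<open>S\<close> would be joined to the component of \<open>c\<close>,
  and the box property would then put \<open>c[i := v]\<close> into \<open>S\<close>.\<close>

lemma slab_disjoint: "p \<in> slab n S i v c \<Longrightarrow> p \<notin> S"
proof
  assume "p \<in> slab n S i v c" "p \<in> S"
  then obtain c' where c': "(c, c') \<in> (adj n S)\<^sup>*" "c'[i := v] \<in> S"
    by (auto simp: slab_def)
  have "(c, c'[i := v]) \<in> (adj n S)\<^sup>*"
    using c' conn_update [of c' S i n v] conn_in c i by (meson rtrancl_trans)
  from conn_box [OF sw this c i] show False
    using cv i len [OF conn_in [OF c'(1) c]] by simp
qed

text \<open>A neighbour in \<open>S\<close> in a direction other than \<open>i\<close> would be
  opposite to the point \<open>c'\<close> below the slab, and switching would put the slab point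
  itself into \<open>S\<close>.\<close>

lemma slab_adjacent:
  assumes "p \<in> slab n S i v c" "l < n" "p[l := y] \<in> S"
  shows "l = i" "(c, p[l := y]) \<in> (adj n S)\<^sup>*"
proof -
  obtain c' where c': "(c, c') \<in> (adj n S)\<^sup>*" "p = c'[i := v]"
    using assms by (auto simp: slab_def)
  have c'S: "c' \<in> S" using conn_in c'(1) c by blast
  show "l = i"
    using switchableD(1) [OF sw c'S, of i v l y] assms slab_disjoint i c' by auto
  then have "p[l := y] = c'[l := y]"
    using c' by simp
  then show "(c, p[l := y]) \<in> (adj n S)\<^sup>*"
    using conn_update [OF c'S] assms c'(1) by (metis rtrancl_trans)
qed

text \<open>As \<open>p\<close> is no lonely corner, one of the two middle corners is in
  \<open>S\<close>. If it is the one in direction \<open>l\<close>, then \<open>l = i\<close>, the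
  far corner belongs to the component of \<open>c\<close>, and \<open>p[k := x]\<close> is its copy
  in the slab.\<close>

lemma slab_corner:
  assumes "p \<in> slab n S i v c" "p[k := x, l := y] \<in> S" "k < n" "l < n" "k \<noteq> l"
  shows "p[k := x] \<in> S \<union> slab n S i v c"
proof (cases "p[k := x] \<in> S")
  case False
  then have "p[l := y] \<in> S"
    using nl assms unfolding slab_def lonely_corner_def by blast
  note adj = slab_adjacent [OF assms(1,4) this]
  let ?q = "p[k := x, l := y]"
  have "?q = (p[l := y])[k := x]"
    using assms by (simp add: list_update_swap)
  then have "(c, ?q) \<in> (adj n S)\<^sup>*"
    using conn_update [OF \<open>p[l := y] \<in> S\<close> assms(3)] adj(2) assms(2) by (metis rtrancl_trans)
  moreover have "p[k := x] = ?q[i := v]"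
    using adj(1) assms(1,5) by (auto simp: slab_def list_update_swap [of k i])
  ultimately show ?thesis
    by (auto simp: slab_def)
qed simp

lemma switchable_slab: "switchable n (S \<union> slab n S i v c)"
  unfolding switchable_def
proof (intro ballI allI impI)
  fix p k l x y
  assume *: "p \<in> S \<union> slab n S i v c" "k < n" "l < n" "k \<noteq> l" "p[k := x, l := y] \<in> S \<union> slab n S i v c"
  let ?q = "p[k := x, l := y]"
  consider "p \<in> S" "?q \<in> S" | "p \<in> slab n S i v c" "?q \<in> S" | "p \<in> S" "?q \<in> slab n S i v c" | "p \<in> slab n S i v c" "?q \<in> slab n S i v c"
    using * by blast
  then show "p[k := x] \<in> S \<union> slab n S i v c"
  proof cases
    case 1
    then show ?thesis using switchableD [OF sw] * by blast
  next
    case 2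
    then show ?thesis using slab_corner * by blast
  next
    case 3
    \<comment> \<open>Read from \<open>?q\<close>, the rectangle starts in the slab and ends in
      \<open>S\<close>.\<close>
    have "?q[l := p ! l, k := p ! k] = p" "?q[l := p ! l] = p[k := x]"
      using *(4) by (simp_all add: list_update_swap [of k l])
    then show ?thesis using slab_corner [OF 3(2), of l "p ! l" k "p ! k"] * 3 by simp
  next
    case 4
    then obtain c1 c2 where c1: "(c, c1) \<in> (adj n S)\<^sup>*" "p = c1[i := v]"
      and c2: "(c, c2) \<in> (adj n S)\<^sup>*" "?q = c2[i := v]"
      by (auto simp: slab_def)
    have S: "c1 \<in> S" "c2 \<in> S" using conn_in c c1 c2 by blast+
    note len = len [OF S(1)] len [OF S(2)]
    have "length p = n" using c1(2) len by simp
    then have q: "?q ! k = x" "?q ! l = y"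
      using *(2-4) by simp_all
    have qi: "?q ! i = v"
      unfolding c2(2) using len i by simp
    consider "k = i" | "l = i" | "k \<noteq> i" "l \<noteq> i" by blast
    then show ?thesis
    proof cases
      case 1
      then have "x = v" using q qi by simp
      then have "p[k := x] = p" using 1 c1 by simp
      then show ?thesis using 4 by simp
    next
      case 2
      then have "y = v" using q qi by simp
      then have "p[k := x] = ?q"
        using 2 c1 *(4) by (simp add: list_update_swap [of k i])
      then show ?thesis using 4 by simp
    next
      case 3
      \<comment> \<open>Both corners are shadows of points of one box, so the mixed point
        \<open>c1[k := c2 ! k]\<close> lies in that box and its copy at level \<open>v\<close> is
        the desired corner.\<close>
      have "(c1, c2) \<in> (adj n S)\<^sup>*"
        using c1 c2 conn_sym by (meson rtrancl_trans)
      from conn_box_conn [OF sw this S(1) *(2)] have "(c, c1[k := c2 ! k]) \<in> (adj n S)\<^sup>*"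
        using c1 by (meson rtrancl_trans)
      moreover have "c2 ! k = x"
        using q(1) 3 unfolding c2(2) by simp
      moreover have "p[k := x] = c1[k := x, i := v]"
        using 3 c1 by (simp add: list_update_swap)
      ultimately show ?thesis by (auto simp: slab_def)
    qed
  qed
qed

end

section \<open>The primes attached to switchable sets\<close>

lemma finite_Nset: "finite (Nset n r)"
proof -
  let ?B = "\<Union>i<n. {..r i}"
  have "Nset n r \<subseteq> {xs. set xs \<subseteq> ?B \<and> length xs = n}"
    by (auto simp: Nset_def in_set_conv_nth) (metis lessThan_iff)
  moreover have "finite {xs. set xs \<subseteq> ?B \<and> length xs = n}"
    by (rule finite_lists_length_eq) simp
  ultimately show ?thesis by (rule finite_subset)
qed

lemma Nset_length: "a \<in> Nset n r \<Longrightarrow> length a = n"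
  by (simp add: Nset_def)

lemma Nset_nth: "a \<in> Nset n r \<Longrightarrow> i < n \<Longrightarrow> 1 \<le> a ! i \<and> a ! i \<le> r i"
  by (simp add: Nset_def)

lemma Nset_update: "a \<in> Nset n r \<Longrightarrow> 1 \<le> v \<Longrightarrow> v \<le> r i \<Longrightarrow> a[i := v] \<in> Nset n r"
  by (cases "i < length a") (auto simp: Nset_def nth_list_update list_update_beyond)

lemma Nset_update2:
  assumes "a \<in> Nset n r" "a[i := v, j := w] \<in> Nset n r" "i < n" "j < n" "i \<noteq> j"
  shows "a[i := v] \<in> Nset n r" "a[j := w] \<in> Nset n r"
  using assms Nset_nth [OF assms(2), of i] Nset_nth [OF assms(2), of j] Nset_length [OF assms(1)]
  by (auto intro!: Nset_update)

lemma fgen_in_poly_ring: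
  assumes "a \<in> Nset n r" "b \<in> Nset n r" "i < n"
  shows "fgen i a b \<in> carrier (poly_ring (Nset n r))"
proof -
  have "sw i a b \<in> Nset n r" "sw i b a \<in> Nset n r"
    using assms Nset_nth [of _ n r i] by (auto simp: sw_def intro!: Nset_update)
  then have "Var a * Var b + - (Var (sw i a b) * Var (sw i b a)) \<in> carrier (poly_ring (Nset n r))"
    using assms by (intro poly_ring_add_closed poly_ring_uminus_closed poly_ring_mult_closed Var_in_poly_ring)
  then show ?thesis by (simp add: fgen_def)
qed

text \<open>The generators in the language of list updates. Degenerate squares are included, since
  their binomial is 0.\<close>

lemma slice_ideal_square:
  assumes "a \<in> Nset n r" "a[i := v, j := w] \<in> Nset n r" "i < n" "j < n" "i \<noteq> j"
  shows "Var a * Var (a[i := v, j := w]) - Var (a[i := v]) * Var (a[j := w]) \<in> slice_ideal n r"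
proof -
  interpret cring "poly_ring (Nset n r)" by (rule cring_poly_ring)
  let ?G = "{fgen i a b | i a b. a \<in> Nset n r \<and> b \<in> Nset n r \<and> hdist n a b = 2 \<and> i < n}"
  have G: "?G \<subseteq> carrier (poly_ring (Nset n r))"
    using fgen_in_poly_ring by blast
  have id: "ideal (slice_ideal n r) (poly_ring (Nset n r))"
    unfolding slice_ideal_def by (rule genideal_ideal [OF G])
  have len: "length a = n" using assms(1) by (rule Nset_length)
  consider "v = a ! i" | "w = a ! j" | "v \<noteq> a ! i" "w \<noteq> a ! j" by blast
  then show ?thesis
  proof cases
    case 1
    then show ?thesis using poly_ideal_zero [OF id] by simp
  next
    case 2
    then show ?thesis using poly_ideal_zero [OF id] assms(5)
      by (simp add: list_update_swap [of i j])
  next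
    case 3
    let ?b = "a[i := v, j := w]"
    have "{k. k < n \<and> a ! k \<noteq> ?b ! k} = {i, j}"
      using 3 assms len by (auto simp: nth_list_update)
    then have "hdist n a ?b = 2"
      using assms(5) by (simp add: hdist_def)
    then have "fgen i a ?b \<in> ?G" using assms by blast
    then have "fgen i a ?b \<in> slice_ideal n r"
      unfolding slice_ideal_def using genideal_self [OF G] by blast
    moreover have "sw i a ?b = a[i := v]" "sw i ?b a = a[j := w]"
      using assms(3-5) len by (simp_all add: sw_def list_update_swap [of j i])
    ultimately show ?thesis by (simp add: fgen_def)
  qed
qed

lemma slice_ideal_subset:
  fixes K :: "(nat list, 'k::field) mpoly set"
  assumes K: "ideal K (poly_ring (Nset n r))"
    and sq: "\<And>a i v j w. \<lbrakk>a \<in> Nset n r; a[i := v, j := w] \<in> Nset n r; i < n; j < n; i \<noteq> j\<rbrakk> \<Longrightarrow>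
      Var a * Var (a[i := v, j := w]) - Var (a[i := v]) * Var (a[j := w]) \<in> K"
  shows "slice_ideal n r \<subseteq> K"
proof -
  interpret cring "poly_ring (Nset n r) :: (nat list, 'k) mpoly ring" by (rule cring_poly_ring)
  have "fgen i a b \<in> K" if *: "a \<in> Nset n r" "b \<in> Nset n r" "hdist n a b = 2" "i < n" for i a b
  \<comment> \<open>If \<open>i\<close> is not one of the two differing coordinates, the generator
    vanishes; otherwise it is the square in direction \<open>i\<close> and the other differing
    direction \<open>j\<close>.\<close>
  proof (cases "a ! i = b ! i")
    case True
    then have "sw i a b = a" "sw i b a = b"
      unfolding sw_def by (metis list_update_id)+
    then show ?thesis using poly_ideal_zero [OF K] by (simp add: fgen_def)
  next
    case False
    have len: "length a = n" "length b = n" using * Nset_length by blast+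
    obtain k l where kl: "{j. j < n \<and> a ! j \<noteq> b ! j} = {k, l}" "k \<noteq> l"
      using *(3) unfolding hdist_def card_2_iff by blast
    have "i \<in> {j. j < n \<and> a ! j \<noteq> b ! j}"
      using False *(4) by simp
    then have "i = k \<or> i = l"
      unfolding kl(1) by simp
    then obtain j where j: "{j. j < n \<and> a ! j \<noteq> b ! j} = {i, j}" "j \<noteq> i"
      using kl by (metis insert_commute)
    have "j \<in> {j. j < n \<and> a ! j \<noteq> b ! j}"
      unfolding j(1) by simp
    then have "j < n" by simp
    have b: "b = a[i := b ! i, j := b ! j]"
    proof (rule nth_equalityI)
      fix k assume "k < length b"
      then show "b ! k = a[i := b ! i, j := b ! j] ! k"
        using j(2) len *(4) \<open>j < n\<close> equalityD1 [OF j(1), THEN subsetD, of k]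
        by (cases "a ! k = b ! k") (auto simp: nth_list_update)
    qed (use len in simp)
    have "sw i b a = a[j := b ! j]"
      by (subst b) (use j(2) in \<open>simp add: sw_def list_update_swap [of j i]\<close>)
    then show ?thesis
      using sq [of a i "b ! i" j "b ! j", folded b] * j(2) \<open>j < n\<close> by (simp add: fgen_def sw_def)
  qed
  then show ?thesis
    unfolding slice_ideal_def by (intro genideal_minimal [OF K]) auto
qed

text \<open>With \<open>\<rho>\<close> a choice of base point in every component \<open>C\<^sub>1 \<times> \<dots> \<times> C\<^sub>n\<close> of \<open>S\<close>, this is the
  exponent of the Segre parametrisation \<open>x\<^sub>a \<mapsto> z \<Prod>\<^sub>i y\<^sub>i(a\<^sub>i)\<close> of that component; the variable \<open>z\<close> is
  the one at the base point, and \<open>y\<^sub>i(v)\<close> is the one at the base point with \<open>i\<close>-th entry \<open>v\<close>.\<close>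
definition segre_exp :: "nat \<Rightarrow> (nat list \<Rightarrow> nat list) \<Rightarrow> nat list \<Rightarrow> nat list \<Rightarrow>\<^sub>0 nat" where
  "segre_exp n \<rho> a = Poly_Mapping.single (\<rho> a) 1 + (\<Sum>i<n. Poly_Mapping.single ((\<rho> a)[i := a ! i]) 1)"

definition slice_prime :: "nat \<Rightarrow> (nat \<Rightarrow> nat) \<Rightarrow> nat list set \<Rightarrow> (nat list \<Rightarrow> nat list) \<Rightarrow> (nat list, 'k::field) mpoly set" where
  "slice_prime n r S \<rho> = mono_ker (Nset n r) S (lin_ext (Nset n r) (segre_exp n \<rho>))"

text \<open>Constancy along edges makes \<open>\<rho>\<close> constant on components; that the base
  point lies in the component is stated separately as connectedness of \<open>a\<close> and
  \<open>\<rho> a\<close>.\<close>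

definition base_choice :: "nat \<Rightarrow> nat list set \<Rightarrow> (nat list \<Rightarrow> nat list) \<Rightarrow> bool" where
  "base_choice n S \<rho> \<longleftrightarrow> (\<forall>a j w. a \<in> S \<longrightarrow> j < n \<longrightarrow> a[j := w] \<in> S \<longrightarrow> \<rho> (a[j := w]) = \<rho> a)"

lemma base_choiceD: "base_choice n S \<rho> \<Longrightarrow> a \<in> S \<Longrightarrow> j < n \<Longrightarrow> a[j := w] \<in> S \<Longrightarrow> \<rho> (a[j := w]) = \<rho> a"
  by (simp add: base_choice_def)

lemma base_choice_conn: "base_choice n S \<rho> \<Longrightarrow> (a, b) \<in> (adj n S)\<^sup>* \<Longrightarrow> \<rho> b = \<rho> a"
  by (rotate_tac, induction rule: rtrancl_induct) (auto simp: adj_def base_choice_def)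

lemma primeideal_slice_prime: "primeideal (slice_prime n r S \<rho> :: (nat list, 'k::field) mpoly set) (poly_ring (Nset n r))"
  unfolding slice_prime_def by (rule primeideal_mono_ker) (rule lin_ext_add)

lemma Var_in_slice_prime_iff:
  assumes "a \<in> Nset n r"
  shows "Var a \<in> (slice_prime n r S \<rho> :: (nat list, 'k::field) mpoly set) \<longleftrightarrow> a \<notin> S"
  using assms Var_in_poly_ring [of a "Nset n r", where ?'b = 'k]
    single_1_neq_0 [of "lin_ext (Nset n r) (segre_exp n \<rho>) (Poly_Mapping.single a 1)", where ?'b = 'k]
  by (auto simp: slice_prime_def mono_ker_def Var_def mono_hom_single simp del: poly_ring_simps(1))

text \<open>By switchability the two diagonals of a square are in \<open>S\<close> together or not
  at all. In the first case all corners share a base point and both diagonals have the same entries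
  in every coordinate, so the two products have the same image.\<close>

lemma slice_ideal_subset_slice_prime:
  assumes sw: "switchable n S" and "S \<subseteq> Nset n r" and \<rho>: "base_choice n S \<rho>"
  shows "slice_ideal n r \<subseteq> (slice_prime n r S \<rho> :: (nat list, 'k::field) mpoly set)"
proof (rule slice_ideal_subset)
  show id: "ideal (slice_prime n r S \<rho> :: (nat list, 'k) mpoly set) (poly_ring (Nset n r))"
    using primeideal_slice_prime primeideal.axioms(1) by blast
  fix a i v j w
  assume *: "a \<in> Nset n r" "a[i := v, j := w] \<in> Nset n r" "i < n" "j < n" "i \<noteq> j"
  let ?\<Phi> = "lin_ext (Nset n r) (segre_exp n \<rho>)"
  define b p q where "b = a[i := v, j := w]" and "p = a[i := v]" and "q = a[j := w]"
  have len: "length a = n" using * Nset_length by blast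
  have N: "b \<in> Nset n r" "p \<in> Nset n r" "q \<in> Nset n r"
    using Nset_update2 [OF *] * by (simp_all add: b_def p_def q_def)
  have pq: "p[i := a ! i, j := w] = q" "p[i := a ! i] = a" "p[j := w] = b"
    using *(5) by (simp_all add: p_def q_def b_def)
  have iff: "a \<in> S \<and> b \<in> S \<longleftrightarrow> p \<in> S \<and> q \<in> S"
    using switchableD [OF sw, of a i v j w] switchableD [OF sw, of p i "a ! i" j w] * pq
    unfolding b_def [symmetric] p_def [symmetric] q_def [symmetric] by auto
  have eq: "segre_exp n \<rho> a + segre_exp n \<rho> b = segre_exp n \<rho> p + segre_exp n \<rho> q"
    if S: "a \<in> S" "b \<in> S" "p \<in> S" "q \<in> S"
  proof -
    have \<rho>s: "\<rho> p = \<rho> a" "\<rho> q = \<rho> a" "\<rho> b = \<rho> a"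
      using base_choiceD [OF \<rho>, of a i v] base_choiceD [OF \<rho>, of a j w] base_choiceD [OF \<rho>, of p j w] S * pq
      by (simp_all add: p_def q_def b_def)
    let ?t = "\<lambda>x k. Poly_Mapping.single ((\<rho> a)[k := x ! k]) (1::nat)"
    have "?t a k + ?t b k = ?t p k + ?t q k" if "k < n" for k
      using that len *(5) by (cases "k = i"; cases "k = j") (simp_all add: b_def p_def q_def add.commute)
    then have "(\<Sum>k<n. ?t a k + ?t b k) = (\<Sum>k<n. ?t p k + ?t q k)"
      by (intro sum.cong) auto
    then show ?thesis
      by (simp add: segre_exp_def \<rho>s sum.distrib algebra_simps)
  qed
  have hom: "mono_hom S ?\<Phi> (Var x * Var y :: (nat list, 'k) mpoly) =
      (if x \<in> S \<and> y \<in> S then Poly_Mapping.single (segre_exp n \<rho> x + segre_exp n \<rho> y) 1 else 0)"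
    if "x \<in> Nset n r" "y \<in> Nset n r" for x y
    using that finite_Nset [of n r]
    by (simp add: Var_def mult_single mono_hom_single keys_add_nat lin_ext_add lin_ext_single del: One_nat_def)
  have "mono_hom S ?\<Phi> (Var a * Var b - Var p * Var q :: (nat list, 'k) mpoly) = 0"
    using hom [of a b] hom [of p q] * N iff eq by (auto simp: mono_hom_diff)
  moreover have "Var a * Var b + - (Var p * Var q) \<in> carrier (poly_ring (Nset n r))"
    using * N by (intro poly_ring_add_closed poly_ring_uminus_closed poly_ring_mult_closed Var_in_poly_ring)
  ultimately show "Var a * Var (a[i := v, j := w]) - Var (a[i := v]) * Var (a[j := w]) \<in>
      (slice_prime n r S \<rho> :: (nat list, 'k) mpoly set)"
    unfolding p_def [symmetric] q_def [symmetric] pq(3) slice_prime_def mono_ker_def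
    by (simp del: poly_ring_simps(1))
qed

text \<open>By \<open>iff\<close>, every point added to \<open>S\<close> involves a target variable
  outside \<open>S\<close>, whereas old points do not; setting these variables to 0 recovers the
  smaller parametrisation.\<close>

lemma slice_prime_antimono:
  assumes "S \<subseteq> S'" "S' \<subseteq> Nset n r" and "\<And>a. a \<in> S \<Longrightarrow> \<rho>' a = \<rho> a"
    and iff: "\<And>a. a \<in> S' \<Longrightarrow> a \<in> S \<longleftrightarrow> Poly_Mapping.keys (segre_exp n \<rho>' a) \<subseteq> S"
  shows "slice_prime n r S' \<rho>' \<subseteq> (slice_prime n r S \<rho> :: (nat list, 'k::field) mpoly set)"
  unfolding slice_prime_def
proof (rule mono_ker_mono [OF assms(1)])
  fix m :: "nat list \<Rightarrow>\<^sub>0 nat"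
  assume "Poly_Mapping.keys m \<subseteq> S"
  then show "lin_ext (Nset n r) (segre_exp n \<rho>') m = lin_ext (Nset n r) (segre_exp n \<rho>) m"
    using assms(3) by (intro lin_ext_cong) (auto simp: segre_exp_def)
next
  fix m :: "nat list \<Rightarrow>\<^sub>0 nat"
  assume m: "Poly_Mapping.keys m \<subseteq> S'"
  then have "Poly_Mapping.keys (lin_ext (Nset n r) (segre_exp n \<rho>') m) = (\<Union>a\<in>Poly_Mapping.keys m. Poly_Mapping.keys (segre_exp n \<rho>' a))"
    using assms(2) by (intro keys_lin_ext finite_Nset) auto
  then show "Poly_Mapping.keys m \<subseteq> S \<longleftrightarrow> Poly_Mapping.keys (lin_ext (Nset n r) (segre_exp n \<rho>') m) \<subseteq> S"
    using m iff by (auto simp: subset_iff)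
qed

lemma keys_segre_exp: "Poly_Mapping.keys (segre_exp n \<rho> a) = insert (\<rho> a) ((\<lambda>i. (\<rho> a)[i := a ! i]) ` {..<n})"
  by (auto simp: segre_exp_def keys_add_nat keys_sum_nat)

section \<open>Segre relations modulo an ideal in which the variables of \<open>S\<close>
  cancel\<close>

context
  fixes n r S and K :: "(nat list, 'k::field) mpoly set"
  assumes K: "ideal K (poly_ring (Nset n r))" and IK: "slice_ideal n r \<subseteq> K"
    and SN: "S \<subseteq> Nset n r" and sw: "switchable n S"
    and cancel: "\<And>c f. c \<in> S \<Longrightarrow> f \<in> carrier (poly_ring (Nset n r)) \<Longrightarrow> Var c * f \<in> K \<Longrightarrow> f \<in> K"
begin

text \<open>The slice minors only relate points at distance 2; cancelling variables of
  \<open>S\<close> carries the exchange of the \<open>i\<close>-th entry along a path. The value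
  \<open>v\<close> is arbitrary, so the relation also reaches points outside
  \<open>S\<close>.\<close>

lemma conn_exchange:
  assumes conn: "(a, b) \<in> (adj n S)\<^sup>*" and "b \<in> S" and i: "i < n" and v: "1 \<le> v" "v \<le> r i"
  shows "Var (a[i := v]) * Var b - Var (a[i := b ! i]) * Var (b[i := v]) \<in> K"
  using conn
proof (induction rule: converse_rtrancl_induct)
  case base
  then show ?case using poly_ideal_zero [OF K] by (simp add: mult.commute)
next
  case (step a a1)
  then obtain j w where a1: "a1 = a[j := w]" "j < n" "a \<in> S" "a1 \<in> S"
    by (auto simp: adj_def)
  show ?case
  proof (cases "i = j")
    case True
    then show ?thesis using step.IH a1 by simp
  next
    case False
    have a1b: "a1[i := b ! i] \<in> S"
      using conn_box [OF sw step.hyps(2) a1(4) i] .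
    have N: "a \<in> Nset n r" "a1 \<in> Nset n r" "b \<in> Nset n r" "a1[i := b ! i] \<in> Nset n r"
      using SN a1 \<open>b \<in> S\<close> a1b by blast+
    have bi: "1 \<le> b ! i" "b ! i \<le> r i" using Nset_nth [OF N(3) i] by auto
    have N': "a[i := v] \<in> Nset n r" "a[i := b ! i] \<in> Nset n r" "b[i := v] \<in> Nset n r" "a1[i := v] \<in> Nset n r"
      using N v bi by (auto intro: Nset_update)
    define X Y Z W B B' :: "(nat list, 'k) mpoly"
      where "X = Var (a[i := v])" and "Y = Var (a1[i := b ! i])" and "Z = Var (a[i := b ! i])"
        and "W = Var (a1[i := v])" and "B = Var b" and "B' = Var (b[i := v])"
    have carr: "X \<in> carrier (poly_ring (Nset n r))" "Z \<in> carrier (poly_ring (Nset n r))"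
      "B \<in> carrier (poly_ring (Nset n r))" "B' \<in> carrier (poly_ring (Nset n r))"
      using N N' by (simp_all add: X_def Z_def B_def B'_def Var_in_poly_ring del: poly_ring_simps(1))
    have "X * Y - Z * W \<in> K"
      using slice_ideal_square [of "a[i := v]" n r i "b ! i" j w] N' N i a1 False IK
      by (auto simp: X_def Y_def Z_def W_def list_update_swap [of j i])
    \<comment> \<open>The minor and the induction hypothesis are combined so that \<open>W\<close>
      drops out and the cancellable \<open>Y\<close> factors out.\<close>
    then have "B * (X * Y - Z * W) + Z * (W * B - Y * B') \<in> K"
      using step.IH carr unfolding W_def [symmetric] B_def [symmetric] Y_def [symmetric] B'_def [symmetric]
      by (intro poly_ideal_add [OF K] poly_ideal_mult [OF K])
    then have "Y * (X * B - Z * B') \<in> K"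
      by (simp add: algebra_simps)
    moreover have "X * B + - (Z * B') \<in> carrier (poly_ring (Nset n r))"
      using carr by (intro poly_ring_add_closed poly_ring_uminus_closed poly_ring_mult_closed)
    ultimately have "X * B - Z * B' \<in> K"
      using cancel [OF a1b, of "X * B - Z * B'"] by (simp add: Y_def del: poly_ring_simps(1))
    then show ?thesis by (simp add: X_def B_def Z_def B'_def)
  qed
qed

text \<open>The Segre parametrisation holds modulo \<open>K\<close>: \<open>c\<close> is turned into
  \<open>a\<close> one coordinate at a time, each exchange costing one factor
  \<open>Var c\<close>.\<close>

lemma base_point_monomial:
  assumes conn: "(c, a) \<in> (adj n S)\<^sup>*" and c: "c \<in> S"
  shows "Var c ^ n * Var a - Var c * (\<Prod>i<n. Var (c[i := a ! i])) \<in> K"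
proof -
  have a: "a \<in> S" using conn_in [OF conn c] .
  have len: "length a = n" "length c = n"
    using a c SN Nset_length by blast+
  have cN: "Var x \<in> carrier (poly_ring (Nset n r))" if "x \<in> S" for x
    by (rule Var_in_poly_ring) (use that SN in blast)
  \<comment> \<open>\<open>p k\<close> agrees with \<open>a\<close> before position \<open>k\<close>
    and with \<open>c\<close> from there on, so it runs from \<open>c\<close> to
    \<open>a\<close>.\<close>
  define p where "p k = take k a @ drop k c" for k
  have p_Suc: "p (Suc k) = (p k)[k := a ! k]" if "k < n" for k
    using that len by (intro nth_equalityI) (auto simp: p_def nth_append nth_list_update)
  have pow: "Var c ^ k \<in> carrier (poly_ring (Nset n r))" for k
    using c SN by (auto simp: Var_power split: if_splits)
  have "k \<le> n \<Longrightarrow> (c, p k) \<in> (adj n S)\<^sup>* \<and> Var c ^ k * Var (p k) - Var c * (\<Prod>i<k. Var (c[i := a ! i])) \<in> K" for k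
  proof (induction k)
    case 0
    then show ?case using poly_ideal_zero [OF K] by (simp add: p_def)
  next
    case (Suc k)
    then have k: "k < n" and cp: "(c, p k) \<in> (adj n S)\<^sup>*"
      and IH: "Var c ^ k * Var (p k) - Var c * (\<Prod>i<k. Var (c[i := a ! i])) \<in> K" by auto
    have pS: "p k \<in> S" using conn_in [OF cp c] .
    have "(p k, a) \<in> (adj n S)\<^sup>*"
      using conn_sym [OF cp] conn by (rule rtrancl_trans)
    from rtrancl_trans [OF cp conn_box_conn [OF sw this pS k]]
    have conn': "(c, p (Suc k)) \<in> (adj n S)\<^sup>*"
      by (simp only: p_Suc [OF k])
    have ck: "c[k := a ! k] \<in> S"
      using conn_box [OF sw conn c k] .
    have "(p k)[k := c ! k] = p k"
      using k len by (simp add: p_def nth_append list_update_same_conv)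
    moreover have "1 \<le> a ! k" "a ! k \<le> r k"
      using Nset_nth [of a n r k] a SN k by auto
    ultimately have "Var (p (Suc k)) * Var c - Var (p k) * Var (c[k := a ! k]) \<in> K"
      using conn_exchange [OF conn_sym [OF cp] c k, of "a ! k"] by (simp only: p_Suc [OF k])
    then have "Var c ^ k * (Var (p (Suc k)) * Var c - Var (p k) * Var (c[k := a ! k]))
        + Var (c[k := a ! k]) * (Var c ^ k * Var (p k) - Var c * (\<Prod>i<k. Var (c[i := a ! i]))) \<in> K"
      using IH cN [OF ck] pow by (intro poly_ideal_add [OF K] poly_ideal_mult [OF K])
    then have "Var c ^ Suc k * Var (p (Suc k)) - Var c * (\<Prod>i<Suc k. Var (c[i := a ! i])) \<in> K"
      by (simp add: algebra_simps)
    with conn' show ?case ..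
  qed
  from this [of n] show ?thesis
    using len by (simp add: p_def)
qed

text \<open>Multiplied by a product of base point variables with exponent \<open>?U m\<close>, a
  monomial over \<open>S\<close> becomes its Segre image read as a monomial in the same ring.
  Monomials with equal image have equal \<open>?U\<close>, and this factor can be cancelled.\<close>

lemma slice_prime_subset:
  assumes \<rho>: "base_choice n S \<rho>" and conn: "\<And>a. a \<in> S \<Longrightarrow> (a, \<rho> a) \<in> (adj n S)\<^sup>*"
    and out: "\<And>a. a \<in> Nset n r \<Longrightarrow> a \<notin> S \<Longrightarrow> Var a \<in> K"
  shows "slice_prime n r S \<rho> \<subseteq> K"
  unfolding slice_prime_def
proof (rule mono_ker_subset_ideal [OF K SN out])
  let ?N = "Nset n r"
  let ?\<Phi> = "lin_ext ?N (segre_exp n \<rho>)"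
  let ?U = "lin_ext ?N (\<lambda>a. Poly_Mapping.single (\<rho> a) n)"
  let ?\<omega> = "lin_ext ?N (\<lambda>a. Poly_Mapping.single (\<rho> a) (1::nat))"
  let ?X = "\<lambda>m. Poly_Mapping.single m (1::'k)"
  have \<rho>S: "\<rho> a \<in> S" if "a \<in> S" for a
    using conn_in conn that by blast
  have \<rho>i: "(\<rho> a)[i := a ! i] \<in> S" "\<rho> ((\<rho> a)[i := a ! i]) = \<rho> a" if "a \<in> S" "i < n" for a i
  proof -
    have *: "(\<rho> a, a) \<in> (adj n S)\<^sup>*" using conn_sym conn that by blast
    show 1: "(\<rho> a)[i := a ! i] \<in> S"
      using conn_box [OF sw * \<rho>S] that by blast
    have "\<rho> (\<rho> a) = \<rho> a"
      using base_choice_conn [OF \<rho> conn] that by blast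
    then show "\<rho> ((\<rho> a)[i := a ! i]) = \<rho> a"
      using base_choiceD [OF \<rho> \<rho>S] 1 that by auto
  qed
  have keys_exp: "Poly_Mapping.keys (segre_exp n \<rho> a) \<subseteq> S" if "a \<in> S" for a
    using that \<rho>S \<rho>i by (auto simp: keys_segre_exp)
  have keysU: "Poly_Mapping.keys (?U m) \<subseteq> S" if "Poly_Mapping.keys m \<subseteq> S" for m
  proof -
    have "Poly_Mapping.keys (?U m) = (\<Union>a\<in>Poly_Mapping.keys m. Poly_Mapping.keys (Poly_Mapping.single (\<rho> a) n))"
      using that SN by (intro keys_lin_ext finite_Nset) auto
    then show ?thesis using that \<rho>S by (auto split: if_splits)
  qed
  have U: "?X (?U m + m) - ?X (?\<Phi> m) \<in> K" if "Poly_Mapping.keys m \<subseteq> S" for m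
    using that
  proof (induction rule: monomial_induct)
    case zero
    then show ?case using poly_ideal_zero [OF K] by simp
  next
    case (add m a)
    have aN: "a \<in> ?N" using add SN by blast
    have "Var (\<rho> a) ^ n * Var a - Var (\<rho> a) * (\<Prod>i<n. Var ((\<rho> a)[i := a ! i])) \<in> K"
      using base_point_monomial [OF conn_sym [OF conn] \<rho>S] add by blast
    then have 1: "?X (Poly_Mapping.single (\<rho> a) n + Poly_Mapping.single a 1) - ?X (segre_exp n \<rho> a) \<in> K"
      unfolding Var_power unfolding Var_def prod_single_1 by (simp add: mult_single segre_exp_def)
    have "?X (?U m + m) * ?X (Poly_Mapping.single (\<rho> a) n + Poly_Mapping.single a 1)
        - ?X (?\<Phi> m) * ?X (segre_exp n \<rho> a) \<in> K"
    proof (rule poly_ideal_diff_mult2 [OF K add.IH 1])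
      show "?X (?U m + m) \<in> carrier (poly_ring ?N)"
        using keysU add SN by (intro single_in_poly_ring) (auto simp: keys_add_nat)
      show "?X (segre_exp n \<rho> a) \<in> carrier (poly_ring ?N)"
        using keys_exp add SN by (intro single_in_poly_ring) auto
    qed
    then show ?case
      using aN by (simp add: mult_single lin_ext_add lin_ext_single finite_Nset add_ac del: One_nat_def)
  qed
  \<comment> \<open>\<open>?\<omega>\<close> counts degrees per component. Each variable contributes
    \<open>n\<close> to \<open>?U\<close> and \<open>n + 1\<close> to the degree of its Segre image,
    so \<open>?\<Phi> m\<close> determines \<open>?U m\<close>.\<close>
  have deg: "n * Poly_Mapping.lookup (?\<omega> (?\<Phi> m)) c = (n + 1) * Poly_Mapping.lookup (?U m) c"
    if "Poly_Mapping.keys m \<subseteq> S" for m c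
    using that
  proof (induction rule: monomial_induct)
    case zero
    then show ?case by simp
  next
    case (add m a)
    have aN: "a \<in> ?N" using add SN by blast
    have "?\<omega> (segre_exp n \<rho> a) = Poly_Mapping.single (\<rho> (\<rho> a)) 1 + (\<Sum>i<n. Poly_Mapping.single (\<rho> ((\<rho> a)[i := a ! i])) 1)"
      unfolding segre_exp_def lin_ext_add lin_ext_sum
      using \<rho>S \<rho>i add SN by (intro arg_cong2 [of _ _ _ _ "(+)"] sum.cong refl lin_ext_single finite_Nset) auto
    also have "\<dots> = Poly_Mapping.single (\<rho> a) 1 + (\<Sum>i<n. Poly_Mapping.single (\<rho> a) 1)"
      using \<rho>i base_choice_conn [OF \<rho> conn] add by (intro arg_cong2 [of _ _ _ _ "(+)"] sum.cong) auto
    finally have "Poly_Mapping.lookup (?\<omega> (segre_exp n \<rho> a)) c = (n + 1 when \<rho> a = c)"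
      by (simp add: lookup_add lookup_sum lookup_single when_def)
    then show ?case
      using aN add.IH
      by (simp add: lin_ext_add lin_ext_single finite_Nset lookup_add lookup_single when_def algebra_simps del: One_nat_def)
  qed
  fix m m' :: "nat list \<Rightarrow>\<^sub>0 nat"
  assume m: "Poly_Mapping.keys m \<subseteq> S" and m': "Poly_Mapping.keys m' \<subseteq> S" and eq: "?\<Phi> m = ?\<Phi> m'"
  have "Poly_Mapping.lookup (?U m) c = Poly_Mapping.lookup (?U m') c" for c
  proof -
    have "(n + 1) * Poly_Mapping.lookup (?U m) c = (n + 1) * Poly_Mapping.lookup (?U m') c"
      unfolding deg [OF m, symmetric] deg [OF m', symmetric] eq ..
    then show ?thesis by (simp only: mult_cancel1) simp
  qed
  then have UU: "?U m = ?U m'"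
    by (rule poly_mapping_eqI)
  have "?X (?U m + m) - ?X (?U m' + m') \<in> K"
    using poly_ideal_diff [OF K U [OF m] U [OF m']] eq by simp
  then have *: "?X (?U m) * (?X m - ?X m') \<in> K"
    by (simp add: UU right_diff_distrib mult_single)
  show "?X m - ?X m' \<in> K"
  proof (rule cancel_monomial [OF cancel SN keysU [OF m] _ *])
    have "?X m + - ?X m' \<in> carrier (poly_ring ?N)"
      using m m' SN by (intro poly_ring_add_closed poly_ring_uminus_closed single_in_poly_ring) auto
    then show "?X m - ?X m' \<in> carrier (poly_ring ?N)" by (simp del: poly_ring_simps(1))
  qed
qed

end

section \<open>Minimal primes\<close>

text \<open>If the conclusion fails, \<open>S\<close> can be enlarged against \<open>max\<close>: by
  \<open>a\<close> as a new component if \<open>a\<close> has no neighbour in \<open>S\<close>, and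
  otherwise by the slab through \<open>a\<close> over the component of a neighbour
  \<open>c\<close>.\<close>

lemma maximal_switchable_corner:
  assumes SN: "S \<subseteq> Nset n r" and sw: "switchable n S"
    and \<rho>: "base_choice n S \<rho>" and conn: "\<And>a. a \<in> S \<Longrightarrow> (a, \<rho> a) \<in> (adj n S)\<^sup>*"
    and max: "\<And>S' \<rho>'. \<lbrakk>S \<subseteq> S'; S' \<subseteq> Nset n r; switchable n S'; base_choice n S' \<rho>'; \<And>a. a \<in> S \<Longrightarrow> \<rho>' a = \<rho> a;
      \<And>a. a \<in> S' \<Longrightarrow> a \<in> S \<longleftrightarrow> Poly_Mapping.keys (segre_exp n \<rho>' a) \<subseteq> S\<rbrakk> \<Longrightarrow> S' \<subseteq> S"
    and a: "a \<in> Nset n r" "a \<notin> S"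
  shows "lonely_corner n S a \<or> (\<exists>c c' i v. i < n \<and> c \<in> S \<and> a = c[i := v] \<and> (c, c') \<in> (adj n S)\<^sup>* \<and>
     lonely_corner n S (c'[i := v]))"
proof (rule ccontr)
  assume neg: "\<not> ?thesis"
  have keysS: "Poly_Mapping.keys (segre_exp n \<rho> p) \<subseteq> S" if "p \<in> S" for p
    using conn_box [OF sw conn_sym [OF conn [OF that]] conn_in [OF conn [OF that] that]] conn_in [OF conn [OF that] that]
    by (auto simp: keys_segre_exp)
  have keys_cong: "segre_exp n \<rho>' p = segre_exp n \<rho> p" if "\<rho>' p = \<rho> p" for \<rho>' p
    using that by (simp add: segre_exp_def)
  show False
  proof (cases "\<exists>i x. i < n \<and> a[i := x] \<in> S")
    case False
    have "insert a S \<subseteq> S"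
    proof (rule max)
      show "switchable n (insert a S)"
        using neg False by (intro switchable_insert [OF sw]) auto
      \<comment> \<open>The isolated point is its own base point, so its image involves the variable
        \<open>a\<close>, which is outside \<open>S\<close>.\<close>
      show "base_choice n (insert a S) (\<rho>(a := a))"
        unfolding base_choice_def
      proof (intro allI impI)
        fix p j w assume *: "p \<in> insert a S" "j < n" "p[j := w] \<in> insert a S"
        have "p[j := w] \<noteq> a" if "p \<in> S"
          using that False *(2) by (metis list_update_id list_update_overwrite)
        moreover have "p[j := w] \<notin> S" if "p = a"
          using that False *(2) by blast
        ultimately show "(\<rho>(a := a)) (p[j := w]) = (\<rho>(a := a)) p"
          using * base_choiceD [OF \<rho>] by auto
      qed
      fix p assume p: "p \<in> insert a S"
      show "p \<in> S \<longleftrightarrow> Poly_Mapping.keys (segre_exp n (\<rho>(a := a)) p) \<subseteq> S"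
      proof (cases "p = a")
        case True
        then show ?thesis using a by (simp add: keys_segre_exp)
      next
        case False
        then show ?thesis using p keysS keys_cong [of "\<rho>(a := a)" p] by simp
      qed
    qed (use a SN in auto)
    then show False using a by blast
  next
    case True
    then obtain i x where i: "i < n" and c: "a[i := x] \<in> S" by blast
    define c v where "c = a[i := x]" and "v = a ! i"
    have cS: "c \<in> S" and av: "a = c[i := v]"
      using c by (simp_all add: c_def v_def)
    have nl: "\<not> lonely_corner n S (c'[i := v])" if "(c, c') \<in> (adj n S)\<^sup>*" for c'
      using neg that i cS av by blast
    have len: "length p = n" if "p \<in> S" for p
      using that SN Nset_length by blast
    have cv: "c[i := v] \<notin> S" using a av by simp
    define E where "E = slab n S i v c"
    have E_iff: "p \<in> E \<longleftrightarrow> (\<exists>c'. p = c'[i := v] \<and> (c, c') \<in> (adj n S)\<^sup>*)" for p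
      unfolding E_def slab_def by blast
    have E_disj: "p \<notin> S" if "p \<in> E" for p
      using slab_disjoint [OF sw len cS i cv nl] that unfolding E_def by blast
    have E_adj: "(c, p[l := y]) \<in> (adj n S)\<^sup>*" if "p \<in> E" "l < n" "p[l := y] \<in> S" for p l y
      using slab_adjacent [OF sw len cS i cv nl] that unfolding E_def by blast
    have v: "1 \<le> v" "v \<le> r i"
      using Nset_nth [OF a(1) i] by (simp_all add: v_def)
    \<comment> \<open>The slab joins the component of \<open>c\<close> and inherits its base point;
      the images of its points are recognised by the variable at \<open>(\<rho> c)[i := v]\<close>,
      which is outside \<open>S\<close>.\<close>
    define \<rho>' where "\<rho>' p = (if p \<in> E then \<rho> c else \<rho> p)" for p
    have \<rho>'E: "\<rho>' p = \<rho> c" if "p \<in> E" for p using that by (simp add: \<rho>'_def)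
    have \<rho>'S: "\<rho>' p = \<rho> p" if "p \<in> S" for p using that E_disj by (auto simp: \<rho>'_def)
    have "S \<union> E \<subseteq> S"
    proof (rule max)
      have "c'[i := v] \<in> Nset n r" if "(c, c') \<in> (adj n S)\<^sup>*" for c'
        using conn_in [OF that cS] SN v by (blast intro: Nset_update)
      then show "S \<union> E \<subseteq> Nset n r" using SN by (auto simp: E_iff)
      show "switchable n (S \<union> E)"
        unfolding E_def by (rule switchable_slab [OF sw len cS i cv nl])
      show "base_choice n (S \<union> E) \<rho>'"
        unfolding base_choice_def
      proof (intro allI impI)
        fix p j w assume *: "p \<in> S \<union> E" "j < n" "p[j := w] \<in> S \<union> E"
        consider "p \<in> S" "p[j := w] \<in> S" | "p \<in> E" "p[j := w] \<in> S" | "p \<in> S" "p[j := w] \<in> E" | "p \<in> E" "p[j := w] \<in> E"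
          using * by blast
        then show "\<rho>' (p[j := w]) = \<rho>' p"
        proof cases
          case 1
          then show ?thesis using base_choiceD [OF \<rho>] \<rho>'S *(2) by simp
        next
          case 2
          then show ?thesis
            using base_choice_conn [OF \<rho> E_adj [OF _ *(2)]] by (simp add: \<rho>'S \<rho>'E)
        next
          case 3
          have "(c, p[j := w, j := p ! j]) \<in> (adj n S)\<^sup>*"
            using 3 *(2) by (intro E_adj) simp_all
          then have "\<rho> p = \<rho> c"
            using base_choice_conn [OF \<rho>, of c p] by simp
          then show ?thesis using 3 by (simp add: \<rho>'S \<rho>'E)
        next
          case 4
          then show ?thesis by (simp add: \<rho>'E)
        qed
      qed
      fix p assume p: "p \<in> S \<union> E"
      show "p \<in> S \<longleftrightarrow> Poly_Mapping.keys (segre_exp n \<rho>' p) \<subseteq> S"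
      proof (cases "p \<in> S")
        case True
        then show ?thesis using keysS keys_cong [of \<rho>' p] \<rho>'S by simp
      next
        case False
        then have pE: "p \<in> E" using p by blast
        then obtain c' where "p = c'[i := v]" "(c, c') \<in> (adj n S)\<^sup>*"
          by (auto simp: E_iff)
        then have "p ! i = v"
          using len [OF conn_in [OF _ cS]] i by simp
        moreover have "(\<rho> c)[i := v] \<in> E"
          using conn [OF cS] by (auto simp: E_iff)
        then have "(\<rho> c)[i := v] \<notin> S" by (rule E_disj)
        ultimately have "\<not> Poly_Mapping.keys (segre_exp n \<rho>' p) \<subseteq> S"
          using i by (auto simp: keys_segre_exp \<rho>'E [OF pE])
        then show ?thesis using False by simp
      qed
    qed (use \<rho>'S in auto)
    moreover have "a \<in> E"
      using av by (auto simp: E_iff)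
    ultimately show False using a by blast
  qed
qed

text \<open>This is the minor of the square witnessing the lonely corner, with \<open>d\<close>
  opposite to \<open>p\<close> and \<open>b\<close>, \<open>b'\<close> the missing corners.\<close>

lemma lonely_corner_reduction:
  assumes "lonely_corner n S p" "p \<in> Nset n r" "S \<subseteq> Nset n r"
  shows "\<exists>d\<in>S. \<exists>b\<in>Nset n r - S. \<exists>b'\<in>Nset n r - S.
    Var d * Var p - Var b * Var b' \<in> (slice_ideal n r :: (nat list, 'k::field) mpoly set)"
proof -
  obtain k l x y where *: "k < n" "l < n" "k \<noteq> l" "p[k := x, l := y] \<in> S" "p[k := x] \<notin> S" "p[l := y] \<notin> S"
    using assms(1) unfolding lonely_corner_def by blast
  have N: "p[k := x, l := y] \<in> Nset n r" using * assms(3) by blast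
  have "Var (p[k := x, l := y]) * Var p - Var (p[k := x]) * Var (p[l := y]) \<in> (slice_ideal n r :: (nat list, 'k) mpoly set)"
    using slice_ideal_square [OF assms(2) N *(1-3)] by (simp add: mult.commute)
  then show ?thesis
    using Nset_update2 [OF assms(2) N *(1-3)] *(4-6) by blast
qed

theorem theorem5p5:
  fixes n :: nat and r :: "nat \<Rightarrow> nat"
    and \<Q> :: "(nat list, 'k::field) mpoly set set"
    and P Q :: "(nat list, 'k::field) mpoly set"
  assumes "n \<ge> 1" and "\<forall>i<n. r i \<ge> 1"
    and "minimal_primary_decomposition (poly_ring (Nset n r)) (slice_ideal n r) \<Q>"
    and "minimal_prime_over P (poly_ring (Nset n r)) (slice_ideal n r)"
    and "Q \<in> \<Q>" and "radical_of (poly_ring (Nset n r)) Q = P"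
  shows "Q = P"
proof -
  let ?N = "Nset n r"
  let ?R = "poly_ring ?N :: (nat list, 'k) mpoly ring"
  let ?I = "slice_ideal n r :: (nat list, 'k) mpoly set"
  have Q: "ideal Q ?R" and IQ: "?I \<subseteq> Q"
    and prim: "\<And>f g. f \<in> carrier ?R \<Longrightarrow> g \<in> carrier ?R \<Longrightarrow> f * g \<in> Q \<Longrightarrow> f \<in> Q \<or> (\<exists>k. g ^ k \<in> Q)"
    using assms(3,5) by (auto simp: minimal_primary_decomposition_def primary_ideal_def simp del: poly_ring_simps(1))
  have P: "primeideal P ?R" and IP: "?I \<subseteq> P"
    and min: "\<And>P'. primeideal P' ?R \<Longrightarrow> ?I \<subseteq> P' \<Longrightarrow> P' \<subseteq> P \<Longrightarrow> P' = P"
    using assms(4) unfolding minimal_prime_over_def by blast+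
  have rad: "f \<in> P \<longleftrightarrow> f \<in> carrier ?R \<and> (\<exists>k. f ^ k \<in> Q)" for f
    using assms(6) unfolding radical_of_def by (auto simp del: poly_ring_simps(1))
  have Pid: "ideal P ?R" using P by (rule primeideal.axioms(1))
  have prime: "f \<in> P \<or> g \<in> P" if "f \<in> carrier ?R" "g \<in> carrier ?R" "f * g \<in> P" for f g
    using primeideal.I_prime [OF P that(1,2)] that(3) by simp
  have VarR: "Var a \<in> carrier ?R" if "a \<in> ?N" for a
    using that by (rule Var_in_poly_ring)
  define S where "S = {a \<in> ?N. (Var a :: (nat list, 'k) mpoly) \<notin> P}"
  have SN: "S \<subseteq> ?N" by (auto simp: S_def)
  have outP: "Var a \<in> P" if "a \<in> ?N" "a \<notin> S" for a
    using that by (simp add: S_def)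
  have cancelP: "f \<in> P" if "c \<in> S" "f \<in> carrier ?R" "Var c * f \<in> P" for c f
    using prime [OF VarR that(2,3)] that(1) by (auto simp: S_def)
  \<comment> \<open>For \<open>c \<in> S\<close> no power of \<open>Var c\<close> lies in
    \<open>Q\<close>, as \<open>P\<close> is the radical of \<open>Q\<close>; so primarity cancels
    it.\<close>
  have cancelQ: "f \<in> Q" if "c \<in> S" "f \<in> carrier ?R" "Var c * f \<in> Q" for c f
    using prim [OF that(2) VarR, of c] that(1,3) rad [of "Var c"] VarR [of c] by (auto simp: S_def mult.commute)
  have sw: "switchable n S"
    unfolding switchable_def
  proof (intro ballI allI impI)
    fix a i j v w
    assume *: "a \<in> S" "i < n" "j < n" "i \<noteq> j" "a[i := v, j := w] \<in> S"
    have aN: "a \<in> ?N" "a[i := v, j := w] \<in> ?N" using * SN by blast+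
    note N = Nset_update2 [OF aN *(2-4)]
    show "a[i := v] \<in> S"
    proof (rule ccontr)
      \<comment> \<open>The minor then puts the product of the two opposite corner variables into
        the prime \<open>P\<close>, although neither of them is in \<open>P\<close>.\<close>
      assume "a[i := v] \<notin> S"
      then have "Var (a[j := w]) * Var (a[i := v]) \<in> P"
        using outP N poly_ideal_mult [OF Pid VarR] by blast
      moreover have "Var a * Var (a[i := v, j := w]) - Var (a[i := v]) * Var (a[j := w]) \<in> P"
        using slice_ideal_square [OF aN *(2-4)] IP by blast
      ultimately have "Var a * Var (a[i := v, j := w]) \<in> P"
        using poly_ideal_add [OF Pid] by (fastforce simp: mult.commute)
      then show False
        using prime VarR aN * by (auto simp: S_def simp del: poly_ring_simps(1))
    qed
  qed
  \<comment> \<open>The choice depends only on the set of points reachable from \<open>a\<close>,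
    hence only on the component.\<close>
  define \<rho> where "\<rho> a = (SOME c. (a, c) \<in> (adj n S)\<^sup>*)" for a
  have conn: "(a, \<rho> a) \<in> (adj n S)\<^sup>*" for a
    unfolding \<rho>_def by (rule someI [of _ a]) simp
  have \<rho>: "base_choice n S \<rho>"
    unfolding base_choice_def
  proof (intro allI impI)
    fix a j w assume "a \<in> S" "j < n" "a[j := w] \<in> S"
    then have *: "(a, a[j := w]) \<in> (adj n S)\<^sup>*" by (rule conn_update)
    have "(a[j := w], c) \<in> (adj n S)\<^sup>* \<longleftrightarrow> (a, c) \<in> (adj n S)\<^sup>*" for c
      using rtrancl_trans [OF *] rtrancl_trans [OF conn_sym [OF *]] by blast
    then show "\<rho> (a[j := w]) = \<rho> a" by (simp add: \<rho>_def)
  qed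
  \<comment> \<open>The kernel is a prime over the slice ideal and lies in \<open>P\<close>, so
    minimality gives equality.\<close>
  have P_eq: "slice_prime n r S \<rho> = P"
    by (intro min primeideal_slice_prime slice_ideal_subset_slice_prime sw SN \<rho>
        slice_prime_subset [OF Pid IP SN sw cancelP \<rho> conn outP])
  have corner: "lonely_corner n S a \<or> (\<exists>c c' i v. i < n \<and> c \<in> S \<and> a = c[i := v] \<and> (c, c') \<in> (adj n S)\<^sup>* \<and>
     lonely_corner n S (c'[i := v]))" if a: "a \<in> ?N" "a \<notin> S" for a
  proof (rule maximal_switchable_corner [OF SN sw \<rho> conn _ a])
    fix S' \<rho>'
    assume *: "S \<subseteq> S'" "S' \<subseteq> ?N" "switchable n S'" "base_choice n S' \<rho>'" "\<And>a. a \<in> S \<Longrightarrow> \<rho>' a = \<rho> a"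
      "\<And>a. a \<in> S' \<Longrightarrow> a \<in> S \<longleftrightarrow> Poly_Mapping.keys (segre_exp n \<rho>' a) \<subseteq> S"
    \<comment> \<open>Minimality again: the prime of the larger set is \<open>P\<close> itself, and
      it contains no variable of \<open>S'\<close>.\<close>
    have "slice_prime n r S' \<rho>' \<subseteq> P"
      unfolding P_eq [symmetric] using * by (intro slice_prime_antimono)
    then have "slice_prime n r S' \<rho>' = P"
      using * by (intro min primeideal_slice_prime slice_ideal_subset_slice_prime)
    then have "Var a \<notin> P" if "a \<in> S'" for a
      using Var_in_slice_prime_iff [of a n r S' \<rho>', where ?'k = 'k] that *(2) by blast
    then show "S' \<subseteq> S"
      using *(2) by (auto simp: S_def)
  qed
  have outQ: "Var a \<in> Q" if "a \<in> ?N" "a \<notin> S" for a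
  proof (rule nilpotent_variables_in_ideal [OF Q finite_Nset, of "?N - S"])
    fix a assume a: "a \<in> ?N - S"
    then show "\<exists>k. Var a ^ k \<in> Q"
      using outP rad by blast
    show "\<exists>b\<in>?N - S. \<exists>b'\<in>?N - S. \<exists>u. \<exists>t\<in>carrier ?R.
        (\<forall>f\<in>carrier ?R. u * f \<in> Q \<longrightarrow> f \<in> Q) \<and> u * Var a - t * (Var b * Var b') \<in> Q"
    proof -
      consider "lonely_corner n S a" | c c' i v where "i < n" "c \<in> S" "a = c[i := v]" "(c, c') \<in> (adj n S)\<^sup>*"
          "lonely_corner n S (c'[i := v])"
        using corner a by blast
      then show ?thesis
      proof cases
        case 1
        \<comment> \<open>Here \<open>u\<close> is \<open>Var d\<close> and \<open>t\<close> is
          1.\<close>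
        then obtain d b b' where d: "d \<in> S" "b \<in> ?N - S" "b' \<in> ?N - S" "Var d * Var a - Var b * Var b' \<in> ?I"
          using lonely_corner_reduction [OF 1 _ SN] a by blast
        have "Var d * Var a - 1 * (Var b * Var b') \<in> Q" "1 \<in> carrier ?R"
          using d(4) IQ by auto
        then show ?thesis using cancelQ [OF d(1)] d(2,3) by blast
      next
        case 2
        have c': "c' \<in> S" using conn_in 2 by blast
        have v: "1 \<le> v" "v \<le> r i"
          using Nset_nth [of a n r i] Nset_length [of c n r] a 2 SN by auto
        have c'v: "c'[i := v] \<in> ?N"
          using c' SN v by (blast intro: Nset_update)
        obtain d b b' where d: "d \<in> S" "b \<in> ?N - S" "b' \<in> ?N - S"
            "Var d * Var (c'[i := v]) - Var b * Var b' \<in> ?I"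
          using lonely_corner_reduction [OF 2(5) c'v SN] by blast
        \<comment> \<open>The lonely corner sits at \<open>c'[i := v]\<close> rather than at
          \<open>a\<close>. The exchange along the component moves it to \<open>a\<close> at the
          cost of \<open>Var c'\<close> and \<open>t\<close>, so \<open>u\<close> is
          \<open>Var d * Var c'\<close>.\<close>
        define t :: "(nat list, 'k) mpoly" where "t = Var (c[i := c' ! i])"
        have "c[i := c' ! i] \<in> S"
          using conn_box [OF sw] 2 by blast
        then have t: "t \<in> carrier ?R"
          unfolding t_def using SN by (intro VarR) blast
        have dR: "Var d \<in> carrier ?R" "Var c' \<in> carrier ?R"
          using d c' SN by (blast intro: VarR)+
        have "Var a * Var c' - t * Var (c'[i := v]) \<in> Q"
          using conn_exchange [OF Q IQ SN sw cancelQ 2(4) c' 2(1) v] 2(3) by (simp add: t_def)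
        then have "Var d * (Var a * Var c' - t * Var (c'[i := v]))
            + t * (Var d * Var (c'[i := v]) - Var b * Var b') \<in> Q"
          using d(4) IQ t dR by (intro poly_ideal_add [OF Q] poly_ideal_mult [OF Q]) blast+
        then have "(Var d * Var c') * Var a - t * (Var b * Var b') \<in> Q"
          by (simp add: algebra_simps)
        moreover have "f \<in> Q" if "f \<in> carrier ?R" "(Var d * Var c') * f \<in> Q" for f
          using cancelQ [OF d(1) poly_ring_mult_closed [OF dR(2) that(1)]] cancelQ [OF c' that(1)] that(2)
          by (simp add: mult.assoc)
        ultimately show ?thesis using d(2,3) t by blast
      qed
    qed
  qed (use that in auto)
  have "P \<subseteq> Q"
    unfolding P_eq [symmetric] by (rule slice_prime_subset [OF Q IQ SN sw cancelQ \<rho> conn outQ])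
  moreover have "Q \<subseteq> P"
  proof
    fix f assume f: "f \<in> Q"
    then have "f ^ 1 \<in> Q" by simp
    moreover have "f \<in> carrier ?R" using f poly_ideal_subset [OF Q] by (rule subsetD [rotated])
    ultimately show "f \<in> P" unfolding rad by blast
  qed
  ultimately show ?thesis by blast
qed

end
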